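(* For even $N_s\ge4$, let $|\psi_0\rangle$ be the ground state at $U=0$, $t>0$ of the Bose-Hubbard Hamiltonian on the periodic ring of $N_s$ sites with $N=N_s$ particles, and let $A\subset\{1,\dots,N_s\}$ be any subset of sites with $|A|=N_s/2$ (in particular the half cut $\{1,\dots,N_s/2\}$ or the alternating cut $\{1,3,\dots,N_s-1\}$). Then, as $N_s\to\infty$, $$S_A=\tfrac12\ln\Big(\frac{\pi e}{2}N_s\Big)+O(N_s^{-1}).$$
   Context: The sites are $\{1,\dots,N_s\}$, with indices modulo $N_s$. At $U=0$ the Hamiltonian is $\mathcal{H}=-t\sum_{i=1}^{N_s}(\hat b_i^\dagger\hat b_{i+1}+\mathrm{H.c.})$ with bosonic operators $\hat b_i,\hat b_i^\dagger$, restricted to the subspace of total particle number $N$; its ground state is $|\psi_0\rangle=(N!)^{-1/2}(\hat b_0^\dagger)^N|0\rangle$ with $\hat b_0^\dagger=N_s^{-1/2}\sum_{j=1}^{N_s}\hat b_j^\dagger$. For $B$ the complement of $A$, the Fock space factorizes as $\mathcal{F}=\mathcal{F}_A\otimes\mathcal{F}_B$, and the entanglement entropy is $S_A=-\mathrm{Tr}[\rho^A\ln\rho^A]$ with $\rho^A=\mathrm{Tr}_B|\psi_0\rangle\langle\psi_0|$. *)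

theory Defs
  imports "HOL-Analysis.Analysis"
begin

text \<open>
  Vectors of the bosonic Fock space over a finite set of sites are represented by their
  amplitudes in the occupation-number basis: \<open>\<psi> n\<close> is the coefficient of the basis vector
  \<open>|n\<rangle>\<close>, where \<open>n i\<close> is the number of bosons on site \<open>i\<close>.
\<close>

type_synonym config = "nat \<Rightarrow> nat"
type_synonym state = "config \<Rightarrow> complex"

definition configs :: "nat set \<Rightarrow> config set" where
  "configs S = {n. \<forall>i. i \<notin> S \<longrightarrow> n i = 0}"

definition fock :: "nat set \<Rightarrow> state set" where
  "fock S = {\<psi>. (\<forall>n. n \<notin> configs S \<longrightarrow> \<psi> n = 0) \<and> (\<lambda>n. (cmod (\<psi> n))\<^sup>2) summable_on UNIV}"

definition sector :: "nat set \<Rightarrow> nat \<Rightarrow> state set" where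
  "sector S N = {\<psi> \<in> fock S. \<forall>n. \<psi> n \<noteq> 0 \<longrightarrow> (\<Sum>i\<in>S. n i) = N}"

definition normalized :: "state \<Rightarrow> bool" where
  "normalized \<psi> \<longleftrightarrow> ((\<lambda>n. (cmod (\<psi> n))\<^sup>2) has_sum 1) UNIV"


text \<open>
  The usual rules \<open>b\<^sub>i |n\<rangle> = \<surd>(n\<^sub>i) |n - e\<^sub>i\<rangle>\<close> and \<open>b\<^sub>i\<^sup>\<dagger> |n\<rangle> = \<surd>(n\<^sub>i + 1) |n + e\<^sub>i\<rangle>\<close>, read off on
  amplitudes. For \<open>n i = 0\<close> the factor \<open>sqrt 0\<close> makes the creation amplitude vanish, so the
  truncated subtraction there is harmless.
\<close>

definition annihil :: "nat \<Rightarrow> state \<Rightarrow> state" where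
  "annihil i \<psi> = (\<lambda>n. of_real (sqrt (real (n i + 1))) * \<psi> (n(i := n i + 1)))"

definition create :: "nat \<Rightarrow> state \<Rightarrow> state" where
  "create i \<psi> = (\<lambda>n. of_real (sqrt (real (n i))) * \<psi> (n(i := n i - 1)))"

lemma canonical_commutation:
  "annihil i (create j \<psi>) n - create j (annihil i \<psi>) n = (if i = j then \<psi> n else 0)"
proof (cases "i = j")
  case True
  have sq: "of_real (sqrt (real k)) * (of_real (sqrt (real k)) * z) = of_nat k * z"
    for k and z :: complex
    by (metis mult.assoc of_nat_0_le_iff of_real_mult of_real_of_nat_eq real_sqrt_mult_self abs_of_nonneg)
  have 1: "annihil i (create i \<psi>) n = of_nat (n i + 1) * \<psi> n"
    using sq[of "n i + 1" "\<psi> n"] by (simp add: annihil_def create_def)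
  have 2: "create i (annihil i \<psi>) n = of_nat (n i) * \<psi> n"
    using sq[of "n i" "\<psi> n"] by (cases "n i") (simp_all add: annihil_def create_def fun_upd_idem)
  show ?thesis unfolding True[symmetric] 1 2 by (simp add: algebra_simps)
next
  case False
  then show ?thesis
    by (simp add: annihil_def create_def fun_upd_twist)
qed


text \<open>The right neighbour of a site of the ring \<open>{1..Ns}\<close>; that of \<open>Ns\<close> is \<open>1\<close>.\<close>

definition next_site :: "nat \<Rightarrow> nat \<Rightarrow> nat" where
  "next_site Ns i = i mod Ns + 1"

definition bose_hubbard :: "nat \<Rightarrow> real \<Rightarrow> real \<Rightarrow> state \<Rightarrow> state" where
  "bose_hubbard Ns t U \<psi> = (\<lambda>n.
     - of_real t * (\<Sum>i = 1..Ns. create i (annihil (next_site Ns i) \<psi>) n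
                               + create (next_site Ns i) (annihil i \<psi>) n)
     + of_real (U / 2) * (\<Sum>i = 1..Ns. of_real (real (n i) * (real (n i) - 1)) * \<psi> n))"

text \<open>
  Normalized eigenvectors for the least eigenvalue of \<open>H\<close> restricted to the \<open>N\<close>-particle
  subspace (\<open>H\<close> is Hermitian, so only real eigenvalues have to be compared).
\<close>

definition ground_state :: "nat set \<Rightarrow> nat \<Rightarrow> (state \<Rightarrow> state) \<Rightarrow> state \<Rightarrow> bool" where
  "ground_state S N H \<psi> \<longleftrightarrow> \<psi> \<in> sector S N \<and> normalized \<psi> \<and>
     (\<exists>E::real. H \<psi> = (\<lambda>n. of_real E * \<psi> n) \<and>
        (\<forall>E'::real. \<forall>\<phi> \<in> sector S N.
           \<phi> \<noteq> (\<lambda>n. 0) \<and> H \<phi> = (\<lambda>n. of_real E' * \<phi> n) \<longrightarrow> E \<le> E'))"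


text \<open>
  Operators on \<open>fock S\<close> are represented by their matrices \<open>\<langle>n|K|n'\<rangle>\<close> in the
  occupation-number basis.
\<close>

type_synonym kernel = "config \<Rightarrow> config \<Rightarrow> complex"

definition kernel_on :: "nat set \<Rightarrow> kernel \<Rightarrow> bool" where
  "kernel_on S K \<longleftrightarrow> (\<forall>n n'. K n n' \<noteq> 0 \<longrightarrow> n \<in> configs S \<and> n' \<in> configs S)"

definition apply_kernel :: "nat set \<Rightarrow> kernel \<Rightarrow> state \<Rightarrow> state" where
  "apply_kernel S K v = (\<lambda>n. \<Sum>\<^sub>\<infinity>n'\<in>configs S. K n n' * v n')"

definition trace_kernel :: "nat set \<Rightarrow> kernel \<Rightarrow> complex" where
  "trace_kernel S K = (\<Sum>\<^sub>\<infinity>n\<in>configs S. K n n)"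

definition pure_density :: "state \<Rightarrow> kernel" where
  "pure_density \<psi> = (\<lambda>n n'. \<psi> n * cnj (\<psi> n'))"

text \<open>
  For disjoint \<open>A\<close> and \<open>B\<close>, the factorization \<open>\<F> = \<F>\<^sub>A \<otimes> \<F>\<^sub>B\<close> identifies \<open>|a\<rangle> \<otimes> |b\<rangle>\<close> with the
  configuration that is \<open>a\<close> on \<open>A\<close> and \<open>b\<close> on \<open>B\<close>, that is, with the pointwise sum of \<open>a\<close> and \<open>b\<close>.
\<close>

definition join :: "config \<Rightarrow> config \<Rightarrow> config" where
  "join a b = (\<lambda>i. a i + b i)"

definition partial_trace :: "nat set \<Rightarrow> nat set \<Rightarrow> kernel \<Rightarrow> kernel" where
  "partial_trace A B K = (\<lambda>a a'.
     if a \<in> configs A \<and> a' \<in> configs A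
     then \<Sum>\<^sub>\<infinity>b\<in>configs B. K (join a b) (join a' b) else 0)"

text \<open>
  Functional calculus: \<open>f(K)\<close> acts as multiplication by \<open>f \<lambda>\<close> on the eigenvectors of \<open>K\<close> for
  \<open>\<lambda>\<close>. For a self-adjoint \<open>K\<close> of finite rank this determines \<open>f(K)\<close>, because each basis vector
  is then a finite sum of eigenvectors (the kernel of \<open>K\<close> included). The reduced density
  operator of a vector with a fixed particle number on finitely many sites has finite rank.
\<close>

definition kernel_fun :: "nat set \<Rightarrow> (real \<Rightarrow> real) \<Rightarrow> kernel \<Rightarrow> kernel" where
  "kernel_fun S f K = (THE L. kernel_on S L \<and>
     (\<forall>(x::real) v. v \<in> fock S \<and> apply_kernel S K v = (\<lambda>n. of_real x * v n) \<longrightarrow>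
        apply_kernel S L v = (\<lambda>n. of_real (f x) * v n)))"

text \<open>The convention \<open>0 ln 0 = 0\<close> holds automatically. The trace is real.\<close>

definition von_neumann_entropy :: "nat set \<Rightarrow> kernel \<Rightarrow> real" where
  "von_neumann_entropy S \<rho> = - Re (trace_kernel S (kernel_fun S (\<lambda>x. x * ln x) \<rho>))"

definition entanglement_entropy :: "nat set \<Rightarrow> nat set \<Rightarrow> state \<Rightarrow> real" where
  "entanglement_entropy S A \<psi> =
     von_neumann_entropy A (partial_trace A (S - A) (pure_density \<psi>))"

end

theory Submission
  imports Defs
begin

text \<open>
  Divide the amplitude of a configuration by its multinomial weight \<open>1 / sqrt (\<Prod>i. n\<^sub>i!)\<close>. The
  eigenvalue equation then says that each value is an average of its neighbours (under hops of
  one particle), so by the maximum principle the only ground state is the condensate. Its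
  Schmidt decomposition has one term for each number \<open>k\<close> of particles in \<open>A\<close>, and for a half cut
  the Schmidt weights are \<open>(N choose k) / 2 ^ N\<close>. So the entropy is that of the symmetric
  binomial distribution, \<open>N ln 2 - ln N! + 2 E[ln K!]\<close>; here \<open>E[ln K!]\<close> is evaluated by
  writing Stirling's formula in terms of \<open>K + 1\<close>, which never vanishes, and expanding about
  the mean. The odd central moments vanish, which leaves an error \<open>O(1 / N)\<close>.
\<close>

subsection \<open>Configurations with a fixed number of particles\<close>

text \<open>The shape of \<open>A\<close> drops out because \<open>weight\<close> factorizes over
  \<open>A\<close> and its complement, and its squared sum over a shell depends only on the number
  of sites. No spectrum has to be computed: the condensate is an eigenvector with energy
  \<open>-2 * t * N\<close>, so the least eigenvalue \<open>E\<close> is at most that, and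
  \<open>- E / t \<ge> 2 * N\<close> is all that the maximum principle asks. An obstacle is that
  functions of an operator are defined by \<open>THE\<close>: the kernel proposed for
  \<open>\<rho> ln \<rho>\<close> must be shown to be the only one with the prescribed action on
  eigenvectors, although the Fock space of \<open>A\<close> is infinite-dimensional. In the
  asymptotics terms of order \<open>N ln N\<close> cancel, so every piece has to be known up to
  \<open>O(1 / N)\<close> after averaging. The Taylor bounds are chosen to hold for all
  \<open>x > -1\<close>, which spares any tail estimate; small \<open>K\<close>, where Stirling's
  remainder and the logarithm are worst, is handled by
  \<open>E[1 / (K + 1)] \<le> 2 / (N + 1)\<close>.\<close>

definition shell :: "nat set \<Rightarrow> nat \<Rightarrow> config set" where
  "shell S k = {n \<in> configs S. (\<Sum>i\<in>S. n i) = k}"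

text \<open>Up to a constant factor these are the condensate amplitudes: expanding the
  \<open>N\<close>-th power of the sum of all creation operators gives
  \<open>N! / \<Prod>i. n\<^sub>i!\<close> times \<open>\<Prod>i. sqrt (n\<^sub>i!)\<close>.\<close>

definition weight :: "nat set \<Rightarrow> config \<Rightarrow> real" where
  "weight S n = (\<Prod>i\<in>S. 1 / sqrt (fact (n i)))"

lemma weight_pos: "weight S n > 0"
  unfolding weight_def by (intro prod_pos) simp

lemma finite_shell [simp]:
  assumes "finite S"
  shows "finite (shell S k)"
proof (rule finite_subset)
  show "shell S k \<subseteq> {n. \<forall>i. (i \<in> S \<longrightarrow> n i \<in> {..k}) \<and> (i \<notin> S \<longrightarrow> n i = 0)}"
    using assms by (auto simp: shell_def configs_def intro: member_le_sum)
  show "finite {n. \<forall>i. (i \<in> S \<longrightarrow> n i \<in> {..k}) \<and> (i \<notin> S \<longrightarrow> n i = (0::nat))}"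
    by (intro finite_set_of_finite_funs assms) simp
qed

lemma shell_subset: "shell A k \<subseteq> configs A"
  by (auto simp: shell_def)

text \<open>This is the multinomial theorem. A configuration on \<open>insert x S\<close> is the
  occupation \<open>j\<close> of \<open>x\<close> together with \<open>k - j\<close> particles on
  \<open>S\<close>, and the sum over \<open>j\<close> is a binomial expansion of
  \<open>(1 + card S) ^ k\<close>.\<close>

lemma sum_weight_shell:
  assumes "finite S"
  shows "(\<Sum>n\<in>shell S k. (weight S n)\<^sup>2) = real (card S) ^ k / fact k"
  using assms
proof (induction S arbitrary: k)
  case empty
  have "shell {} k = (if k = 0 then {\<lambda>_. 0} else {})"
    by (auto simp: shell_def configs_def)
  then show ?case by (simp add: weight_def)
next
  case (insert x S)
  have w: "(weight (insert x S) (n(x := j)))\<^sup>2 = (weight S n)\<^sup>2 / fact j" for n j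
  proof -
    have "weight S (n(x := j)) = weight S n"
      unfolding weight_def using insert.hyps by (intro prod.cong) auto
    moreover have "weight (insert x S) (n(x := j)) = 1 / sqrt (fact j) * weight S (n(x := j))"
      using insert.hyps by (simp add: weight_def)
    ultimately show ?thesis by (simp add: power_divide)
  qed
  have s: "(\<Sum>i\<in>S. (n(x := j)) i) = (\<Sum>i\<in>S. n i)" for n :: config and j
    using insert.hyps by (intro sum.cong) auto
  have "(\<Sum>n\<in>shell (insert x S) k. (weight (insert x S) n)\<^sup>2)
      = (\<Sum>(j, n)\<in>(SIGMA j:{..k}. shell S (k - j)). (weight S n)\<^sup>2 / fact j)"
  proof (rule sum.reindex_bij_witness[of _ "\<lambda>(j, n). n(x := j)" "\<lambda>n. (n x, n(x := 0))"])
    fix n assume n: "n \<in> shell (insert x S) k"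
    then show "(n x, n(x := 0)) \<in> (SIGMA j:{..k}. shell S (k - j))"
      using insert.hyps s[of n 0] by (auto simp: shell_def configs_def)
    show "(case (n x, n(x := 0)) of (j, n) \<Rightarrow> (weight S n)\<^sup>2 / fact j) = (weight (insert x S) n)\<^sup>2"
      using w[of "n(x := 0)" "n x"] by simp
  next
    fix jn assume jn: "jn \<in> (SIGMA j:{..k}. shell S (k - j))"
    then show "(case jn of (j, n) \<Rightarrow> n(x := j)) \<in> shell (insert x S) k"
      using insert.hyps s by (auto simp: shell_def configs_def)
    show "((case jn of (j, n) \<Rightarrow> n(x := j)) x, (case jn of (j, n) \<Rightarrow> n(x := j))(x := 0)) = jn"
      using jn insert.hyps by (auto simp: shell_def configs_def)
  qed auto
  also have "\<dots> = (\<Sum>j\<le>k. \<Sum>n\<in>shell S (k - j). (weight S n)\<^sup>2 / fact j)"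
    using insert.hyps by (subst sum.Sigma) auto
  also have "\<dots> = (\<Sum>j\<le>k. (real (card S) ^ (k - j) / fact (k - j)) / fact j)"
    by (simp add: sum_divide_distrib[symmetric] insert.IH)
  also have "\<dots> = (\<Sum>j\<le>k. real (k choose j) * 1 ^ j * real (card S) ^ (k - j)) / fact k"
    unfolding sum_divide_distrib
    by (intro sum.cong refl) (simp add: binomial_fact field_simps)
  also have "\<dots> = (1 + real (card S)) ^ k / fact k"
    by (simp add: binomial_ring)
  finally show ?case using insert.hyps by simp
qed

subsection \<open>The ground state\<close>

text \<open>Natural subtraction makes a hop out of an empty site create a particle. Every use
  carries the factor \<open>n i\<close> or the hypothesis \<open>n i > 0\<close>, so that value
  never counts.\<close>

definition hop :: "nat \<Rightarrow> nat \<Rightarrow> config \<Rightarrow> config" where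
  "hop i j n = n(i := n i - 1, j := n j + 1)"

lemma weight_add_particle:
  assumes "finite S" "i \<in> S"
  shows "weight S (n(i := n i + 1)) * sqrt (real (n i + 1)) = weight S n"
proof -
  have split: "weight S n' = weight (S - {i}) n' / sqrt (fact (n' i))" for n'
    unfolding weight_def using assms by (subst prod.remove[of S i]) auto
  have "weight (S - {i}) (n(i := n i + 1)) = weight (S - {i}) n"
    unfolding weight_def by (intro prod.cong) auto
  then show ?thesis
    unfolding split[of n] split[of "n(i := n i + 1)"]
    by (simp add: real_sqrt_mult del: of_nat_Suc)
qed

lemma weight_hop:
  assumes "finite S" "i \<in> S" "j \<in> S" "i \<noteq> j" "n i > 0"
  shows "weight S (hop i j n) * sqrt (real (n j + 1)) = weight S n * sqrt (real (n i))"
proof -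
  let ?n = "n(i := n i - 1)"
  have "hop i j n = ?n(j := ?n j + 1)" "n = ?n(i := ?n i + 1)" "?n j = n j" "?n i + 1 = n i"
    using assms by (auto simp: hop_def)
  with weight_add_particle[OF assms(1,3), of ?n] weight_add_particle[OF assms(1,2), of ?n]
  show ?thesis by metis
qed

text \<open>Dividing by \<open>weight\<close> turns the matrix element
  \<open>sqrt (n i * (n j + 1))\<close> into \<open>n i\<close>. This is what makes the coefficients
  of the eigenvalue equation add up to a constant. For \<open>n i = 0\<close> both sides
  vanish.\<close>

lemma create_annihil_weight:
  assumes "finite S" "i \<in> S" "j \<in> S" "i \<noteq> j"
  shows "create i (annihil j (\<lambda>n. of_real (weight S n) * \<phi> n)) n
    = of_real (weight S n) * (of_nat (n i) * \<phi> (hop i j n))"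
proof (cases "n i > 0")
  case True
  have eq: "create i (annihil j (\<lambda>n. of_real (weight S n) * \<phi> n)) n
      = of_real (sqrt (real (n i)) * (weight S (hop i j n) * sqrt (real (n j + 1)))) * \<phi> (hop i j n)"
    using assms(4) by (simp add: create_def annihil_def hop_def)
  have "sqrt (real (n i)) * (weight S (hop i j n) * sqrt (real (n j + 1))) = weight S n * real (n i)"
    unfolding weight_hop[of S i j n, OF assms True] by simp
  then show ?thesis unfolding eq by simp
qed (simp add: create_def)

text \<open>Two choices of \<open>h\<close> matter: \<open>h = 1\<close> gives conservation of the
  particle number, and \<open>h l = l\<close> gives a quantity that drops by one when a particle
  moves one site to the left. The additive form avoids natural subtraction.\<close>

lemma sum_hop:
  fixes h :: "nat \<Rightarrow> nat"
  assumes "finite S" "i \<in> S" "j \<in> S" "i \<noteq> j" "n i > 0"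
  shows "(\<Sum>l\<in>S. h l * hop i j n l) + h i = (\<Sum>l\<in>S. h l * n l) + h j"
proof -
  have add: "(\<Sum>l\<in>S. h l * (n(i := n i + 1)) l) = (\<Sum>l\<in>S. h l * n l) + h i" if "i \<in> S" for i n
  proof -
    have "(\<Sum>l\<in>S - {i}. h l * (n(i := n i + 1)) l) = (\<Sum>l\<in>S - {i}. h l * n l)"
      by (intro sum.cong) auto
    then show ?thesis using assms(1) that by (simp add: sum.remove[of S i])
  qed
  let ?n = "n(i := n i - 1)"
  have "hop i j n = ?n(j := ?n j + 1)" "n = ?n(i := ?n i + 1)"
    using assms by (auto simp: hop_def)
  with add[of j ?n] add[of i ?n] assms show ?thesis by simp
qed

lemma hop_mem_shell_iff:
  assumes "finite S" "i \<in> S" "j \<in> S" "i \<noteq> j" "n i > 0"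
  shows "hop i j n \<in> shell S N \<longleftrightarrow> n \<in> shell S N"
proof -
  have "hop i j n \<in> configs S \<longleftrightarrow> n \<in> configs S"
    using assms by (auto simp: configs_def hop_def)
  moreover have "(\<Sum>l\<in>S. hop i j n l) = (\<Sum>l\<in>S. n l)"
    using sum_hop[of S i j n "\<lambda>_. 1"] assms by simp
  ultimately show ?thesis by (simp add: shell_def)
qed

lemma finite_support_fock:
  assumes "finite F" "F \<subseteq> configs A" "\<And>n. n \<notin> F \<Longrightarrow> \<psi> n = 0"
  shows "\<psi> \<in> fock A"
proof -
  have "(\<lambda>n. (cmod (\<psi> n))\<^sup>2) summable_on F" using assms(1) by (rule summable_on_finite)
  then have "(\<lambda>n. (cmod (\<psi> n))\<^sup>2) summable_on UNIV"
    by (rule summable_on_cong_neutral[THEN iffD1, rotated -1]) (use assms in auto)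
  then show ?thesis using assms by (auto simp: fock_def)
qed

section \<open>The hopping operator on the ring\<close>

context
  fixes Ns :: nat
  assumes Ns: "Ns \<ge> 2"
begin

lemma next_site_mem: "i \<in> {1..Ns} \<Longrightarrow> next_site Ns i \<in> {1..Ns}"
  using Ns mod_less_divisor[of Ns i] by (auto simp: next_site_def Suc_le_eq)

lemma next_site_less: "i < Ns \<Longrightarrow> next_site Ns i = Suc i"
  by (simp add: next_site_def)

lemma next_site_neq: "i \<in> {1..Ns} \<Longrightarrow> i \<noteq> next_site Ns i"
  using Ns by (cases "i = Ns") (auto simp: next_site_def)

lemma bij_next_site: "bij_betw (next_site Ns) {1..Ns} {1..Ns}"
proof -
  have "inj_on (next_site Ns) {1..Ns}"
  proof (rule inj_onI)
    fix i j assume "i \<in> {1..Ns}" "j \<in> {1..Ns}" "next_site Ns i = next_site Ns j"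
    then show "i = j" by (cases "i = Ns"; cases "j = Ns") (auto simp: next_site_def)
  qed
  moreover have "next_site Ns ` {1..Ns} \<subseteq> {1..Ns}" using next_site_mem by blast
  ultimately show ?thesis by (simp add: bij_betw_def endo_inj_surj)
qed

definition hop_sum :: "(config \<Rightarrow> complex) \<Rightarrow> config \<Rightarrow> complex" where
  "hop_sum \<phi> n = (\<Sum>i\<in>{1..Ns}. of_nat (n i) * \<phi> (hop i (next_site Ns i) n) + of_nat (n (next_site Ns i)) * \<phi> (hop (next_site Ns i) i n))"

lemma bose_hubbard_weight:
  "bose_hubbard Ns t 0 (\<lambda>n. of_real (weight {1..Ns} n) * \<phi> n) n
     = of_real (weight {1..Ns} n) * (- of_real t * hop_sum \<phi> n)"
proof -
  have "(\<Sum>i\<in>{1..Ns}. create i (annihil (next_site Ns i) (\<lambda>n. of_real (weight {1..Ns} n) * \<phi> n)) n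
          + create (next_site Ns i) (annihil i (\<lambda>n. of_real (weight {1..Ns} n) * \<phi> n)) n)
      = (\<Sum>i\<in>{1..Ns}. of_real (weight {1..Ns} n) * (of_nat (n i) * \<phi> (hop i (next_site Ns i) n) + of_nat (n (next_site Ns i)) * \<phi> (hop (next_site Ns i) i n)))"
  proof (intro sum.cong refl)
    fix i assume i: "i \<in> {1..Ns}"
    note neq = next_site_neq[OF i]
    show "create i (annihil (next_site Ns i) (\<lambda>n. of_real (weight {1..Ns} n) * \<phi> n)) n
          + create (next_site Ns i) (annihil i (\<lambda>n. of_real (weight {1..Ns} n) * \<phi> n)) n
        = of_real (weight {1..Ns} n) * (of_nat (n i) * \<phi> (hop i (next_site Ns i) n) + of_nat (n (next_site Ns i)) * \<phi> (hop (next_site Ns i) i n))"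
      unfolding create_annihil_weight[OF finite_atLeastAtMost i next_site_mem[OF i] neq]
        create_annihil_weight[OF finite_atLeastAtMost next_site_mem[OF i] i neq[symmetric]]
      by (simp add: distrib_left)
  qed
  then show ?thesis
    unfolding bose_hubbard_def hop_sum_def by (simp add: sum_distrib_left mult.left_commute)
qed

lemma sum_hop_weights: "n \<in> shell {1..Ns} N \<Longrightarrow> (\<Sum>i\<in>{1..Ns}. real (n i) + real (n (next_site Ns i))) = 2 * real N"
  using sum.reindex_bij_betw[OF bij_next_site, of "\<lambda>i. real (n i)"]
  by (auto simp: sum.distrib shell_def)

text \<open>A term with nonzero coefficient stays in the shell or stays outside it, so it repeats
  the value at \<open>n\<close>; on the shell the coefficients sum to \<open>2 * N\<close>. This
  function is the condensate divided by \<open>weight\<close>, and its energy is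
  \<open>-2 * t * N\<close>.\<close>

lemma hop_sum_shell_indicator: "hop_sum (indicator (shell {1..Ns} N)) n = of_nat (2 * N) * indicator (shell {1..Ns} N) n"
proof -
  have "hop_sum (indicator (shell {1..Ns} N)) n
      = (\<Sum>i\<in>{1..Ns}. of_real (real (n i) + real (n (next_site Ns i))) * indicator (shell {1..Ns} N) n)"
    unfolding hop_sum_def
  proof (intro sum.cong refl)
    fix i assume i: "i \<in> {1..Ns}"
    note neq = next_site_neq[OF i]
    have "of_nat (n i) * indicator (shell {1..Ns} N) (hop i (next_site Ns i) n) = (of_nat (n i) * indicator (shell {1..Ns} N) n :: complex)"
      using hop_mem_shell_iff[OF finite_atLeastAtMost i next_site_mem[OF i] neq, of n N]
      by (cases "n i > 0") (auto simp: indicator_def)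
    moreover have "of_nat (n (next_site Ns i)) * indicator (shell {1..Ns} N) (hop (next_site Ns i) i n) = (of_nat (n (next_site Ns i)) * indicator (shell {1..Ns} N) n :: complex)"
      using hop_mem_shell_iff[OF finite_atLeastAtMost next_site_mem[OF i] i neq[symmetric], of n N]
      by (cases "n (next_site Ns i) > 0") (auto simp: indicator_def)
    ultimately show "of_nat (n i) * indicator (shell {1..Ns} N) (hop i (next_site Ns i) n) + of_nat (n (next_site Ns i)) * indicator (shell {1..Ns} N) (hop (next_site Ns i) i n)
       = of_real (real (n i) + real (n (next_site Ns i))) * (indicator (shell {1..Ns} N) n :: complex)"
      by (simp only: of_real_add of_real_of_nat_eq distrib_right)
  qed
  also have "\<dots> = of_real (\<Sum>i\<in>{1..Ns}. real (n i) + real (n (next_site Ns i))) * indicator (shell {1..Ns} N) n"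
    by (simp only: sum_distrib_right of_real_sum)
  also have "\<dots> = of_nat (2 * N) * indicator (shell {1..Ns} N) n"
    using sum_hop_weights[of n N] by (auto simp: indicator_def simp del: of_real_sum)
  finally show ?thesis .
qed

text \<open>
  On amplitudes divided by \<open>weight\<close>, the hopping operator is a positive combination of neighbour
  values with total weight \<open>2 * N\<close>, so an eigenvector for a value at least \<open>2 * N\<close> obeys the
  maximum principle.
\<close>

lemma maximum_principle:
  assumes n: "n \<in> shell {1..Ns} N" and max: "\<And>n'. n' \<in> shell {1..Ns} N \<Longrightarrow> cmod (\<phi> n') \<le> cmod (\<phi> n)"
    and eig: "hop_sum \<phi> n = of_real \<mu> * \<phi> n" and \<mu>: "\<mu> \<ge> 2 * real N" and i: "i \<in> {1..Ns}"
  shows "n i > 0 \<Longrightarrow> \<phi> (hop i (next_site Ns i) n) = \<phi> n" and "n (next_site Ns i) > 0 \<Longrightarrow> \<phi> (hop (next_site Ns i) i n) = \<phi> n"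
proof -
  have *: "(n i > 0 \<longrightarrow> \<phi> (hop i (next_site Ns i) n) = \<phi> n) \<and> (n (next_site Ns i) > 0 \<longrightarrow> \<phi> (hop (next_site Ns i) i n) = \<phi> n)"
  proof (cases "\<phi> n = 0")
    case True
    with max have "\<phi> n' = 0" if "n' \<in> shell {1..Ns} N" for n' using that by force
    moreover have "n i > 0 \<Longrightarrow> hop i (next_site Ns i) n \<in> shell {1..Ns} N"
      using n i next_site_mem[OF i] next_site_neq[OF i] by (subst hop_mem_shell_iff) auto
    moreover have "n (next_site Ns i) > 0 \<Longrightarrow> hop (next_site Ns i) i n \<in> shell {1..Ns} N"
      using n i next_site_mem[OF i] next_site_neq[OF i] by (subst hop_mem_shell_iff) auto
    ultimately show ?thesis using True by simp
  next
    case False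
    \<comment> \<open>After normalization by the value at the maximum, real parts suffice:
      \<open>cmod z \<le> 1\<close> and \<open>Re z = 1\<close> force \<open>z = 1\<close>.\<close>
    define z where "z n' = \<phi> n' / \<phi> n" for n'
    have z: "cmod (z n') \<le> 1" if "n' \<in> shell {1..Ns} N" for n'
      using max[OF that] False by (simp add: z_def norm_divide divide_le_eq_1)
    have Re_z: "Re (z n') \<le> 1" if "n' \<in> shell {1..Ns} N" for n'
      using z[OF that] complex_Re_le_cmod[of "z n'"] by linarith
    have z1: "\<phi> n' = \<phi> n" if "n' \<in> shell {1..Ns} N" "Re (z n') = 1" for n'
    proof -
      have "(Re (z n'))\<^sup>2 + (Im (z n'))\<^sup>2 \<le> 1"
        using z[OF that(1)] by (simp add: cmod_def)
      with that(2) have "z n' = 1" by (simp add: complex_eq_iff)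
      with False show ?thesis by (simp add: z_def)
    qed
    have hop1: "hop j (next_site Ns j) n \<in> shell {1..Ns} N" if "n j > 0" "j \<in> {1..Ns}" for j
      using n that next_site_mem[of j] next_site_neq[of j] by (subst hop_mem_shell_iff) auto
    have hop2: "hop (next_site Ns j) j n \<in> shell {1..Ns} N" if "n (next_site Ns j) > 0" "j \<in> {1..Ns}" for j
      using n that next_site_mem[of j] next_site_neq[of j] by (subst hop_mem_shell_iff) auto
    \<comment> \<open>These defects are nonnegative, and the real part of the eigenvalue equation
      says that they sum to \<open>2 * N - \<mu>\<close>, which is at most 0. So each of them
      vanishes.\<close>
    let ?a = "\<lambda>j. real (n j) * (1 - Re (z (hop j (next_site Ns j) n)))"
    let ?b = "\<lambda>j. real (n (next_site Ns j)) * (1 - Re (z (hop (next_site Ns j) j n)))"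
    have a: "?a j \<ge> 0" if "j \<in> {1..Ns}" for j
      using hop1[OF _ that] Re_z by (cases "n j = 0") auto
    have b: "?b j \<ge> 0" if "j \<in> {1..Ns}" for j
      using hop2[OF _ that] Re_z by (cases "n (next_site Ns j) = 0") auto
    have "hop_sum z n = of_real \<mu>"
      using eig False by (simp add: hop_sum_def z_def sum_divide_distrib[symmetric] add_divide_distrib[symmetric])
    then have "Re (hop_sum z n) = \<mu>" by simp
    then have "(\<Sum>j\<in>{1..Ns}. real (n j) * Re (z (hop j (next_site Ns j) n)) + real (n (next_site Ns j)) * Re (z (hop (next_site Ns j) j n))) = \<mu>"
      by (simp add: hop_sum_def Re_sum)
    moreover have "(\<Sum>j\<in>{1..Ns}. ?a j + ?b j) = (\<Sum>j\<in>{1..Ns}. real (n j) + real (n (next_site Ns j)))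
        - (\<Sum>j\<in>{1..Ns}. real (n j) * Re (z (hop j (next_site Ns j) n)) + real (n (next_site Ns j)) * Re (z (hop (next_site Ns j) j n)))"
      by (simp add: sum_subtractf[symmetric] algebra_simps)
    ultimately have "(\<Sum>j\<in>{1..Ns}. ?a j + ?b j) \<le> 0"
      using sum_hop_weights[OF n] \<mu> by linarith
    moreover have nonneg: "\<And>j. j \<in> {1..Ns} \<Longrightarrow> ?a j + ?b j \<ge> 0" using a b by (simp add: add_nonneg_nonneg)
    ultimately have "(\<Sum>j\<in>{1..Ns}. ?a j + ?b j) = 0" by (meson order_antisym sum_nonneg)
    from sum_nonneg_0[OF finite_atLeastAtMost nonneg this i] have "?a i + ?b i = 0" .
    with a[OF i] b[OF i] have "?a i = 0" "?b i = 0" by linarith+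
    then show ?thesis using z1 hop1[OF _ i] hop2[OF _ i] by auto
  qed
  show "n i > 0 \<Longrightarrow> \<phi> (hop i (next_site Ns i) n) = \<phi> n" and "n (next_site Ns i) > 0 \<Longrightarrow> \<phi> (hop (next_site Ns i) i n) = \<phi> n"
    using * by auto
qed

text \<open>Any configuration is connected to the one with all particles on site 1 by moving
  particles to the left one step at a time, and the maximum principle carries the maximal value
  along every such hop, in both directions.\<close>

lemma top_eigenfunction_constant:
  assumes eig: "\<And>n. n \<in> shell {1..Ns} N \<Longrightarrow> hop_sum \<phi> n = of_real \<mu> * \<phi> n" and \<mu>: "\<mu> \<ge> 2 * real N"
  shows "\<exists>c. \<forall>n\<in>shell {1..Ns} N. \<phi> n = c"
proof -
  define base where "base = (\<lambda>i::nat. if i = 1 then N else 0)"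
  have base: "base \<in> shell {1..Ns} N"
    using Ns by (auto simp: base_def shell_def configs_def)
  let ?M = "Max ((\<lambda>n. cmod (\<phi> n)) ` shell {1..Ns} N)"
  have fin: "finite ((\<lambda>n. cmod (\<phi> n)) ` shell {1..Ns} N)" by simp
  have "?M \<in> (\<lambda>n. cmod (\<phi> n)) ` shell {1..Ns} N" using fin base by (intro Max_in) auto
  then obtain m where m: "m \<in> shell {1..Ns} N" "cmod (\<phi> m) = ?M" by auto
  have max: "cmod (\<phi> n') \<le> cmod (\<phi> m)" if "n' \<in> shell {1..Ns} N" for n'
    using m(2) Max_ge[OF fin] that by auto
  \<comment> \<open>The equivalence lets one induction serve twice: taken at \<open>n = m\<close> it
    brings the maximal value down to \<open>base\<close>, and at any other \<open>n\<close> it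
    brings it back up. The induction measure is the sum of all particle positions.\<close>
  have "\<phi> n = \<phi> m \<longleftrightarrow> \<phi> base = \<phi> m" if "n \<in> shell {1..Ns} N" for n
    using that
  proof (induction "\<Sum>l\<in>{1..Ns}. l * n l" arbitrary: n rule: less_induct)
    case less
    show ?case
    proof (cases "\<exists>i\<in>{1..Ns}. i \<noteq> 1 \<and> n i > 0")
      case False
      then have "n i = base i" for i
      proof (cases "i = 1")
        case True
        have "N = (\<Sum>l\<in>{1..Ns}. n l)" using less.prems by (simp add: shell_def)
        also have "\<dots> = (\<Sum>l\<in>{1}. n l)" using False Ns by (intro sum.mono_neutral_right) auto
        finally show ?thesis using True by (simp add: base_def)
      qed (use less.prems in \<open>auto simp: base_def shell_def configs_def\<close>)
      then have "n = base" by blast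
      then show ?thesis by simp
    next
      case True
      then obtain j where j: "j \<in> {1..Ns}" "j \<noteq> 1" "n j > 0" by blast
      define i where "i = j - 1"
      have i: "Suc i \<in> {1..Ns}" "i \<in> {1..Ns}" "n (Suc i) > 0" using j by (auto simp: i_def)
      let ?n = "hop (Suc i) i n"
      have s: "next_site Ns i = Suc i" using i by (simp add: next_site_less)
      have n: "?n \<in> shell {1..Ns} N" using less.prems i by (subst hop_mem_shell_iff) auto
      have "(\<Sum>l\<in>{1..Ns}. l * ?n l) + Suc i = (\<Sum>l\<in>{1..Ns}. l * n l) + i"
        using i by (intro sum_hop[of "{1..Ns}" _ _ _ "\<lambda>l. l"]) auto
      then have IH: "\<phi> ?n = \<phi> m \<longleftrightarrow> \<phi> base = \<phi> m" using n by (intro less.hyps) auto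
      have reverse: "hop i (next_site Ns i) ?n = n" "?n i > 0" using i by (auto simp: hop_def s)
      have "\<phi> n = \<phi> m \<longleftrightarrow> \<phi> ?n = \<phi> m"
      proof
        assume "\<phi> n = \<phi> m"
        then have "\<phi> (hop (next_site Ns i) i n) = \<phi> n"
          using max i(3) by (intro maximum_principle(2)[OF less.prems _ eig[OF less.prems] \<mu> i(2)]) (simp_all add: s)
        with \<open>\<phi> n = \<phi> m\<close> show "\<phi> ?n = \<phi> m" by (simp add: s)
      next
        assume "\<phi> ?n = \<phi> m"
        then have "\<phi> (hop i (next_site Ns i) ?n) = \<phi> ?n"
          using max reverse(2) by (intro maximum_principle(1)[OF n _ eig[OF n] \<mu> i(2)]) simp_all
        with \<open>\<phi> ?n = \<phi> m\<close> show "\<phi> n = \<phi> m" by (simp add: reverse(1))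
      qed
      with IH show ?thesis by simp
    qed
  qed
  with m(1) have "\<forall>n\<in>shell {1..Ns} N. \<phi> n = \<phi> m" by blast
  then show ?thesis by blast
qed

text \<open>Minimality of \<open>E\<close> is used only against the condensate
  \<open>\<phi>0\<close>, which yields \<open>- E / t \<ge> 2 * N\<close> and hence a constant
  quotient \<open>\<psi> / weight\<close>. Normalization then fixes the modulus of the constant; its
  phase stays free.\<close>

lemma ground_state_unique:
  assumes "t > 0" and gs: "ground_state {1..Ns} N (bose_hubbard Ns t 0) \<psi>"
  obtains c where "\<And>n. \<psi> n = of_real (weight {1..Ns} n) * (c * indicator (shell {1..Ns} N) n)"
    and "(cmod c)\<^sup>2 * (real Ns ^ N / fact N) = 1"
proof -
  let ?H = "bose_hubbard Ns t 0"
  define \<phi>0 where "\<phi>0 = (\<lambda>n. of_real (weight {1..Ns} n) * indicator (shell {1..Ns} N) n :: complex)"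
  define \<phi> where "\<phi> n = \<psi> n / of_real (weight {1..Ns} n)" for n
  have w: "weight {1..Ns} n \<noteq> 0" for n using weight_pos[of "{1..Ns}" n] by simp
  have \<psi>: "\<psi> = (\<lambda>n. of_real (weight {1..Ns} n) * \<phi> n)" using w by (simp add: \<phi>_def)
  from gs obtain E where sec: "\<psi> \<in> sector {1..Ns} N" and "normalized \<psi>"
    and HE: "?H \<psi> = (\<lambda>n. of_real E * \<psi> n)"
    and least: "\<And>E' \<phi>. \<phi> \<in> sector {1..Ns} N \<Longrightarrow> \<phi> \<noteq> (\<lambda>n. 0) \<Longrightarrow> ?H \<phi> = (\<lambda>n. of_real E' * \<phi> n) \<Longrightarrow> E \<le> E'"
    unfolding ground_state_def by blast
  have "E \<le> - (t * real (2 * N))"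
  proof (rule least)
    have "\<phi>0 \<in> fock {1..Ns}"
      by (rule finite_support_fock[of "shell {1..Ns} N"]) (simp_all add: \<phi>0_def shell_subset)
    then show "\<phi>0 \<in> sector {1..Ns} N"
      by (auto simp: sector_def \<phi>0_def shell_def indicator_def split: if_splits)
    have "(\<lambda>i. if i = 1 then N else 0) \<in> shell {1..Ns} N"
      using Ns by (auto simp: shell_def configs_def)
    then have "\<phi>0 (\<lambda>i. if i = 1 then N else 0) \<noteq> 0" using w by (simp add: \<phi>0_def)
    then show "\<phi>0 \<noteq> (\<lambda>n. 0)" by auto
    show "?H \<phi>0 = (\<lambda>n. of_real (- (t * real (2 * N))) * \<phi>0 n)"
    proof (rule ext)
      fix n show "?H \<phi>0 n = of_real (- (t * real (2 * N))) * \<phi>0 n"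
        unfolding \<phi>0_def bose_hubbard_weight hop_sum_shell_indicator by simp
    qed
  qed
  then have \<mu>: "- E / t \<ge> 2 * real N" using assms(1) by (simp add: field_simps)
  have "hop_sum \<phi> n = of_real (- E / t) * \<phi> n" for n
  proof -
    have "of_real (weight {1..Ns} n) * (- of_real t * hop_sum \<phi> n) = of_real E * (of_real (weight {1..Ns} n) * \<phi> n)"
      using fun_cong[OF HE, of n] unfolding \<psi> bose_hubbard_weight .
    then have "of_real (weight {1..Ns} n) * (- of_real t * hop_sum \<phi> n)
        = of_real (weight {1..Ns} n) * (of_real E * \<phi> n)"
      by (simp only: mult.left_commute)
    then have "- of_real t * hop_sum \<phi> n = of_real E * \<phi> n" using w[of n] by (simp only: mult_cancel_left of_real_eq_0_iff) simp
    then have "of_real t * hop_sum \<phi> n = - (of_real E * \<phi> n)"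
      by (metis add.inverse_inverse mult_minus_left)
    then show ?thesis using assms(1) by (simp add: field_simps)
  qed
  from top_eigenfunction_constant[OF this \<mu>] obtain c where c: "\<And>n. n \<in> shell {1..Ns} N \<Longrightarrow> \<phi> n = c" by auto
  have "\<psi> n = 0" if "n \<notin> shell {1..Ns} N" for n
    using sec that by (auto simp: sector_def fock_def shell_def)
  then have form: "\<psi> n = of_real (weight {1..Ns} n) * (c * indicator (shell {1..Ns} N) n)" for n
    using c[of n] fun_cong[OF \<psi>, of n] by (auto simp: indicator_def)
  have "((\<lambda>n. (cmod (\<psi> n))\<^sup>2) has_sum 1) (shell {1..Ns} N)"
    using \<open>normalized \<psi>\<close> unfolding normalized_def
    by (rule has_sum_cong_neutral[THEN iffD1, rotated -1]) (auto simp: form)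
  moreover have "((\<lambda>n. (cmod (\<psi> n))\<^sup>2) has_sum (\<Sum>n\<in>shell {1..Ns} N. (cmod (\<psi> n))\<^sup>2)) (shell {1..Ns} N)"
    by (intro has_sum_finite) simp
  ultimately have "1 = (\<Sum>n\<in>shell {1..Ns} N. (cmod (\<psi> n))\<^sup>2)" by (rule has_sum_unique)
  also have "\<dots> = (\<Sum>n\<in>shell {1..Ns} N. (cmod c)\<^sup>2 * (weight {1..Ns} n)\<^sup>2)"
    by (intro sum.cong) (auto simp: form norm_mult power_mult_distrib)
  also have "\<dots> = (cmod c)\<^sup>2 * (real Ns ^ N / fact N)"
    using sum_weight_shell[of "{1..Ns}" N] by (simp add: sum_distrib_left[symmetric])
  finally show ?thesis using that form by metis
qed

end

subsection \<open>Operators that are of rank one on each particle-number sector\<close>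

text \<open>The direct sum over \<open>k\<close> of \<open>p k\<close> times the projection-like
  operator \<open>|u\<^sub>k><u\<^sub>k|\<close>, where \<open>u\<^sub>k\<close> is the restriction
  of \<open>u\<close> to the shell of \<open>k\<close> particles. Once these are unit vectors, the
  \<open>p k\<close> are the eigenvalues belonging to them.\<close>

definition block_kernel :: "nat set \<Rightarrow> (config \<Rightarrow> real) \<Rightarrow> (nat \<Rightarrow> real) \<Rightarrow> kernel" where
  "block_kernel A u p = (\<lambda>a a'. if a \<in> configs A \<and> a' \<in> configs A \<and> (\<Sum>i\<in>A. a i) = (\<Sum>i\<in>A. a' i)
     then of_real (p (\<Sum>i\<in>A. a i) * u a * u a') else 0)"

lemma apply_kernel_finite_support:
  assumes "finite F" "F \<subseteq> configs A" "\<And>n'. n' \<in> configs A - F \<Longrightarrow> K n n' * v n' = 0"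
  shows "apply_kernel A K v n = (\<Sum>n'\<in>F. K n n' * v n')"
proof -
  have "(\<Sum>\<^sub>\<infinity>n'\<in>configs A. K n n' * v n') = (\<Sum>\<^sub>\<infinity>n'\<in>F. K n n' * v n')"
    by (rule infsum_cong_neutral) (use assms in auto)
  then show ?thesis using assms(1) by (simp add: apply_kernel_def)
qed

lemma apply_block_kernel:
  assumes "finite A"
  shows "apply_kernel A (block_kernel A u p) v n
    = (if n \<in> configs A then of_real (p (\<Sum>i\<in>A. n i) * u n) * (\<Sum>n'\<in>shell A (\<Sum>i\<in>A. n i). of_real (u n') * v n') else 0)"
proof -
  let ?k = "\<Sum>i\<in>A. n i"
  have "apply_kernel A (block_kernel A u p) v n = (\<Sum>n'\<in>shell A ?k. block_kernel A u p n n' * v n')"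
    by (rule apply_kernel_finite_support[OF finite_shell[OF assms] shell_subset])
       (auto simp: block_kernel_def shell_def)
  also have "\<dots> = (\<Sum>n'\<in>shell A ?k. (if n \<in> configs A then of_real (p ?k * u n) * (of_real (u n') * v n') else 0))"
    by (intro sum.cong) (auto simp: block_kernel_def shell_def)
  finally show ?thesis by (simp add: sum_distrib_left)
qed

text \<open>Both existence and uniqueness are due, because of \<open>THE\<close>. With
  \<open>f 0 = 0\<close> the huge null space of the operator contributes nothing, so the result is
  again a block kernel with the same vectors.\<close>

lemma kernel_fun_block_kernel:
  assumes A: "finite A" and norm: "\<And>k. (\<Sum>n\<in>shell A k. (u n)\<^sup>2) = 1" and f0: "f 0 = 0"
  shows "kernel_fun A f (block_kernel A u p) = block_kernel A u (\<lambda>k. f (p k))"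
  unfolding kernel_fun_def
proof (rule the_equality)
  let ?K = "block_kernel A u p" and ?L = "block_kernel A u (\<lambda>k. f (p k))"
  let ?c = "\<lambda>v k. \<Sum>n'\<in>shell A k. of_real (u n') * v n' :: complex"
  have normc: "(\<Sum>n\<in>shell A k. of_real (u n) * of_real (u n)) = (1::complex)" for k
    using arg_cong[OF norm[of k], of complex_of_real] by (simp add: power2_eq_square)
  show "kernel_on A ?L \<and> (\<forall>x v. v \<in> fock A \<and> apply_kernel A ?K v = (\<lambda>n. of_real x * v n) \<longrightarrow>
        apply_kernel A ?L v = (\<lambda>n. of_real (f x) * v n))"
  proof (intro conjI allI impI ext)
    show "kernel_on A ?L" by (auto simp: kernel_on_def block_kernel_def split: if_splits)
    fix x v n
    assume "v \<in> fock A \<and> apply_kernel A ?K v = (\<lambda>n. of_real x * v n)"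
    then have v: "v \<in> fock A" and eig: "\<And>n. apply_kernel A ?K v n = of_real x * v n" by auto
    show "apply_kernel A ?L v n = of_real (f x) * v n"
    proof (cases "n \<in> configs A")
      case False
      then show ?thesis using v by (simp add: apply_block_kernel A fock_def)
    next
      case True
      let ?k = "\<Sum>i\<in>A. n i"
      have e: "of_real (p ?k * u n') * ?c v ?k = of_real x * v n'" if "n' \<in> shell A ?k" for n'
        using eig[of n'] that by (simp add: apply_block_kernel A shell_def)
      have en: "of_real (p ?k * u n) * ?c v ?k = of_real x * v n"
        using e[of n] True by (simp add: shell_def)
      \<comment> \<open>Pairing the eigenvalue equation with \<open>u\<close> on the shell shows
        that the overlap \<open>?c v ?k\<close> is zero or \<open>x = p ?k\<close>.\<close>
      have "of_real x * ?c v ?k = (\<Sum>n'\<in>shell A ?k. of_real (u n') * (of_real x * v n'))"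
        by (simp add: sum_distrib_left mult.left_commute)
      also have "\<dots> = (\<Sum>n'\<in>shell A ?k. of_real (u n') * (of_real (p ?k * u n') * ?c v ?k))"
        by (intro sum.cong refl) (simp only: e)
      also have "\<dots> = of_real (p ?k) * ?c v ?k * (\<Sum>n\<in>shell A ?k. of_real (u n) * of_real (u n))"
        unfolding sum_distrib_left[where r = "of_real (p ?k) * ?c v ?k"] by (intro sum.cong refl) simp
      also have "\<dots> = of_real (p ?k) * ?c v ?k" by (simp only: normc mult_1_right)
      finally have xc: "of_real x * ?c v ?k = of_real (p ?k) * ?c v ?k" .
      have "of_real (f (p ?k) * u n) * ?c v ?k = of_real (f x) * v n"
      proof (cases "?c v ?k = 0")
        \<comment> \<open>Without overlap the equation reads \<open>x * v n = 0\<close>; if it is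
          \<open>x\<close> that vanishes, the claim rests on \<open>f 0 = 0\<close>.\<close>
        case True
        then show ?thesis using en f0 by auto
      next
        case False
        then have x: "x = p ?k" using xc by simp
        show ?thesis
        proof (cases "x = 0")
          case True
          then show ?thesis using f0 x by auto
        next
          case False
          then have "of_real (u n) * ?c v ?k = v n" using en x by (simp add: mult.assoc)
          then show ?thesis using x by (simp add: mult.assoc)
        qed
      qed
      then show ?thesis using True by (simp add: apply_block_kernel A)
    qed
  qed
  fix L
  assume L: "kernel_on A L \<and> (\<forall>x v. v \<in> fock A \<and> apply_kernel A ?K v = (\<lambda>n. of_real x * v n) \<longrightarrow>
        apply_kernel A L v = (\<lambda>n. of_real (f x) * v n))"
  show "L = ?L"
  proof (intro ext)
    fix a a'
    show "L a a' = ?L a a'"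
    proof (cases "a' \<in> configs A")
      case False
      then show ?thesis using L by (auto simp: kernel_on_def block_kernel_def)
    next
      case True
      define k where "k = (\<Sum>i\<in>A. a' i)"
      have a': "a' \<in> shell A k" using True by (simp add: shell_def k_def)
      \<comment> \<open>The basis vector at \<open>a'\<close> is \<open>u a' * U + W\<close>. Here
        \<open>U\<close> is an eigenvector for \<open>p k\<close>, and \<open>W\<close> is
        orthogonal to \<open>u\<close> on every shell, hence an eigenvector for 0. So the column of
        \<open>L\<close> at \<open>a'\<close> is forced.\<close>
      define U where "U n = (if n \<in> shell A k then of_real (u n) else 0 :: complex)" for n
      define W where "W n = (if n = a' then 1 else 0) - of_real (u a') * U n" for n
      have supp: "U n = 0" "W n = 0" if "n \<notin> shell A k" for n
        using that a' by (auto simp: U_def W_def)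
      have U: "U \<in> fock A" and W: "W \<in> fock A"
        using supp by (auto intro!: finite_support_fock[of "shell A k"] A shell_subset finite_shell)
      have cU: "?c U j = (if j = k then 1 else 0)" for j
      proof (cases "j = k")
        case True
        then show ?thesis using normc[of k] by (simp add: U_def)
      qed (auto simp: U_def shell_def intro!: sum.neutral)
      have "?c (\<lambda>n. if n = a' then 1 else 0) j = (if j = k then of_real (u a') else 0)" for j
      proof -
        have "?c (\<lambda>n. if n = a' then 1 else 0) j = (\<Sum>n\<in>shell A j. if n = a' then of_real (u n) else 0)"
          by (intro sum.cong) auto
        also have "\<dots> = (if a' \<in> shell A j then of_real (u a') else 0)"
          by (rule sum.delta[OF finite_shell[OF A]])
        also have "a' \<in> shell A j \<longleftrightarrow> j = k" using a' by (auto simp: shell_def)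
        finally show ?thesis .
      qed
      moreover have "?c W j = ?c (\<lambda>n. if n = a' then 1 else 0) j - of_real (u a') * ?c U j" for j
        unfolding sum_distrib_left sum_subtractf[symmetric] by (intro sum.cong refl) (simp add: W_def algebra_simps)
      ultimately have cW: "?c W j = 0" for j using cU[of j] by simp
      have "apply_kernel A ?K U = (\<lambda>n. of_real (p k) * U n)"
      proof (rule ext)
        fix n
        show "apply_kernel A ?K U n = of_real (p k) * U n"
        proof (cases "n \<in> shell A k")
          case True
          then have "n \<in> configs A" "(\<Sum>i\<in>A. n i) = k" by (auto simp: shell_def)
          then show ?thesis using True by (simp add: apply_block_kernel A cU) (simp add: U_def)
        next
          case False
          then have "n \<in> configs A \<Longrightarrow> (\<Sum>i\<in>A. n i) \<noteq> k" by (auto simp: shell_def)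
          then show ?thesis using False by (simp add: apply_block_kernel A cU supp)
        qed
      qed
      with L U have "apply_kernel A L U = (\<lambda>n. of_real (f (p k)) * U n)" by blast
      moreover have app: "apply_kernel A L v a = (\<Sum>n\<in>shell A k. L a n * v n)" if "\<And>n. n \<notin> shell A k \<Longrightarrow> v n = 0" for v
        by (rule apply_kernel_finite_support[OF finite_shell[OF A] shell_subset]) (use that in auto)
      ultimately have LU: "(\<Sum>n\<in>shell A k. L a n * U n) = of_real (f (p k)) * U a"
        using supp(1) by (metis (no_types, lifting))
      have "apply_kernel A ?K W = (\<lambda>n. of_real 0 * W n)"
        by (rule ext) (simp add: apply_block_kernel A cW)
      with L W have "apply_kernel A L W = (\<lambda>n. of_real (f 0) * W n)" by blast
      then have "0 = (\<Sum>n\<in>shell A k. L a n * W n)" using app[of W] supp(2) f0 by simp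
      also have "\<dots> = (\<Sum>n\<in>shell A k. if n = a' then L a n else 0) - of_real (u a') * (\<Sum>n\<in>shell A k. L a n * U n)"
        unfolding sum_distrib_left sum_subtractf[symmetric] by (intro sum.cong) (auto simp: W_def algebra_simps)
      also have "\<dots> = L a a' - of_real (u a') * (of_real (f (p k)) * U a)"
        using A a' by (simp add: LU)
      finally have "L a a' = of_real (u a') * (of_real (f (p k)) * U a)" by simp
      then show ?thesis using True by (auto simp: block_kernel_def U_def shell_def k_def)
    qed
  qed
qed

lemma trace_block_kernel:
  assumes A: "finite A" and norm: "\<And>k. (\<Sum>n\<in>shell A k. (u n)\<^sup>2) = 1" and q: "\<And>k. k > N \<Longrightarrow> q k = 0"
  shows "trace_kernel A (block_kernel A u q) = of_real (\<Sum>k\<le>N. q k)"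
proof -
  let ?F = "\<Union>k\<le>N. shell A k"
  have "trace_kernel A (block_kernel A u q) = (\<Sum>\<^sub>\<infinity>n\<in>?F. block_kernel A u q n n)"
    unfolding trace_kernel_def
    by (rule infsum_cong_neutral) (use q in \<open>auto simp: shell_def block_kernel_def not_le\<close>)
  also have "\<dots> = (\<Sum>n\<in>?F. block_kernel A u q n n)" using A by (intro infsum_finite finite_UN_I finite_atMost finite_shell)
  also have "\<dots> = (\<Sum>k\<le>N. \<Sum>n\<in>shell A k. block_kernel A u q n n)"
    using A by (intro sum.UNION_disjoint finite_atMost ballI finite_shell) (auto simp: shell_def)
  also have "\<dots> = (\<Sum>k\<le>N. \<Sum>n\<in>shell A k. of_real (q k * (u n)\<^sup>2))"
    by (intro sum.cong refl) (auto simp: shell_def block_kernel_def power2_eq_square)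
  also have "\<dots> = (\<Sum>k\<le>N. of_real (q k * (\<Sum>n\<in>shell A k. (u n)\<^sup>2)))"
    by (simp only: sum_distrib_left of_real_sum)
  finally show ?thesis by (simp add: norm)
qed

text \<open>The function \<open>x * ln x\<close> vanishes at 0, so the functional calculus keeps the
  block form, and the trace over unit vectors leaves the Shannon entropy of the
  \<open>p k\<close>.\<close>

lemma entropy_block_kernel:
  assumes A: "finite A" and norm: "\<And>k. (\<Sum>n\<in>shell A k. (u n)\<^sup>2) = 1" and p: "\<And>k. k > N \<Longrightarrow> p k = 0"
  shows "von_neumann_entropy A (block_kernel A u p) = - (\<Sum>k\<le>N. p k * ln (p k))"
  unfolding von_neumann_entropy_def
  by (subst kernel_fun_block_kernel[OF A norm], simp, subst trace_block_kernel[OF A norm, of N]) (simp_all add: p)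

subsection \<open>The reduced density operator\<close>

text \<open>The vector \<open>u\<close> is \<open>weight A\<close> normalized on each shell by means
  of \<open>sum_weight_shell\<close>, which is possible on every shell because \<open>A\<close> is
  nonempty. The \<open>p k\<close> form the binomial distribution of \<open>N\<close> particles that
  fall into \<open>A\<close> independently with probability \<open>card A / card S\<close>.\<close>

lemma partial_trace_condensate:
  assumes S: "finite S" and AS: "A \<subseteq> S" and A: "A \<noteq> {}"
    and \<psi>: "\<And>n. \<psi> n = of_real (weight S n) * (c * indicator (shell S N) n)"
    and c: "(cmod c)\<^sup>2 * (real (card S) ^ N / fact N) = 1"
  defines "u \<equiv> \<lambda>a. weight A a * sqrt (fact (\<Sum>i\<in>A. a i) / real (card A) ^ (\<Sum>i\<in>A. a i))"
    and "p \<equiv> \<lambda>k. if k \<le> N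
       then real (N choose k) * real (card A) ^ k * real (card (S - A)) ^ (N - k) / real (card S) ^ N else 0"
  shows "partial_trace A (S - A) (pure_density \<psi>) = block_kernel A u p"
    and "\<And>k. (\<Sum>n\<in>shell A k. (u n)\<^sup>2) = 1"
proof -
  let ?B = "S - A"
  have fA: "finite A" using S AS finite_subset by auto
  have mA: "real (card A) > 0" using fA A by (simp add: card_gt_0_iff)
  show "(\<Sum>n\<in>shell A k. (u n)\<^sup>2) = 1" for k
  proof -
    have "(\<Sum>n\<in>shell A k. (u n)\<^sup>2) = (\<Sum>n\<in>shell A k. (weight A n)\<^sup>2 * (fact k / real (card A) ^ k))"
      by (intro sum.cong) (auto simp: u_def shell_def power_mult_distrib)
    also have "\<dots> = (\<Sum>n\<in>shell A k. (weight A n)\<^sup>2) * (fact k / real (card A) ^ k)"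
      by (simp only: sum_distrib_right)
    finally show ?thesis using mA by (simp add: sum_weight_shell[OF fA])
  qed
  have w: "weight S (join a b) = weight A a * weight ?B b"
    and s: "(\<Sum>i\<in>S. join a b i) = (\<Sum>i\<in>A. a i) + (\<Sum>i\<in>?B. b i)"
    and cf: "join a b \<in> configs S" if "a \<in> configs A" "b \<in> configs ?B" for a b
  proof -
    have a: "join a b i = a i" if "i \<in> A" for i using \<open>b \<in> configs ?B\<close> that by (auto simp: join_def configs_def)
    have b: "join a b i = b i" if "i \<in> ?B" for i using \<open>a \<in> configs A\<close> that by (auto simp: join_def configs_def)
    have "weight S (join a b) = weight A (join a b) * weight ?B (join a b)"
      unfolding weight_def using prod.subset_diff[OF AS S] by (simp add: mult.commute)
    also have "weight A (join a b) = weight A a" unfolding weight_def by (intro prod.cong) (auto simp: a)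
    also have "weight ?B (join a b) = weight ?B b" unfolding weight_def by (intro prod.cong) (auto simp: b)
    finally show "weight S (join a b) = weight A a * weight ?B b" .
    have "(\<Sum>i\<in>S. join a b i) = (\<Sum>i\<in>A. join a b i) + (\<Sum>i\<in>?B. join a b i)"
      using sum.subset_diff[OF AS S] by (simp add: add.commute)
    then show "(\<Sum>i\<in>S. join a b i) = (\<Sum>i\<in>A. a i) + (\<Sum>i\<in>?B. b i)" by (simp add: a b)
    show "join a b \<in> configs S" using that AS by (auto simp: configs_def join_def)
  qed
  show "partial_trace A ?B (pure_density \<psi>) = block_kernel A u p"
  proof (intro ext)
    fix a a'
    show "partial_trace A ?B (pure_density \<psi>) a a' = block_kernel A u p a a'"
    proof (cases "a \<in> configs A \<and> a' \<in> configs A")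
      case False
      then show ?thesis by (auto simp: partial_trace_def block_kernel_def)
    next
      case True
      let ?k = "\<Sum>i\<in>A. a i" and ?k' = "\<Sum>i\<in>A. a' i"
      \<comment> \<open>The phase of \<open>c\<close> cancels. Since \<open>a\<close> and
        \<open>a'\<close> are completed by the same \<open>b\<close>, only equal particle numbers on
        \<open>A\<close> survive the trace.\<close>
      have val: "pure_density \<psi> (join a b) (join a' b) =
         (if ?k + (\<Sum>i\<in>?B. b i) = N \<and> ?k' + (\<Sum>i\<in>?B. b i) = N
          then of_real ((cmod c)\<^sup>2 * weight A a * weight A a' * (weight ?B b)\<^sup>2) else 0)" if "b \<in> configs ?B" for b
      proof -
        have "c * cnj c = of_real ((cmod c)\<^sup>2)" by (rule complex_norm_square[symmetric])
        then have "pure_density \<psi> (join a b) (join a' b)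
            = of_real ((cmod c)\<^sup>2 * weight A a * weight A a' * (weight ?B b)\<^sup>2)
              * (indicator (shell S N) (join a b) * indicator (shell S N) (join a' b))"
          using True that by (simp add: pure_density_def \<psi> w power2_eq_square indicator_def)
        moreover have "join a b \<in> shell S N \<longleftrightarrow> ?k + (\<Sum>i\<in>?B. b i) = N"
          "join a' b \<in> shell S N \<longleftrightarrow> ?k' + (\<Sum>i\<in>?B. b i) = N"
          using True that by (simp_all add: shell_def s cf)
        ultimately show ?thesis by (simp add: indicator_def)
      qed
      have pt: "partial_trace A ?B (pure_density \<psi>) a a' = (\<Sum>\<^sub>\<infinity>b\<in>configs ?B. pure_density \<psi> (join a b) (join a' b))"
        using True by (simp add: partial_trace_def)
      show ?thesis
      proof (cases "?k = ?k' \<and> ?k \<le> N")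
        case False
        then have "partial_trace A ?B (pure_density \<psi>) a a' = 0"
          unfolding pt by (intro infsum_0) (auto simp: val)
        then show ?thesis using False by (auto simp: block_kernel_def p_def)
      next
        case k: True
        have "partial_trace A ?B (pure_density \<psi>) a a'
          = (\<Sum>\<^sub>\<infinity>b\<in>shell ?B (N - ?k). of_real ((cmod c)\<^sup>2 * weight A a * weight A a' * (weight ?B b)\<^sup>2))"
          unfolding pt by (rule infsum_cong_neutral) (use k in \<open>auto simp: val shell_def\<close>)
        also have "\<dots> = (\<Sum>b\<in>shell ?B (N - ?k). of_real ((cmod c)\<^sup>2 * weight A a * weight A a' * (weight ?B b)\<^sup>2))"
          using S by (intro infsum_finite) simp
        also have "\<dots> = of_real ((cmod c)\<^sup>2 * weight A a * weight A a' * (\<Sum>b\<in>shell ?B (N - ?k). (weight ?B b)\<^sup>2))"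
          by (simp only: sum_distrib_left of_real_sum)
        also have "(\<Sum>b\<in>shell ?B (N - ?k). (weight ?B b)\<^sup>2) = real (card ?B) ^ (N - ?k) / fact (N - ?k)"
          using S by (intro sum_weight_shell) simp
        also have "(cmod c)\<^sup>2 * weight A a * weight A a' * (real (card ?B) ^ (N - ?k) / fact (N - ?k)) = p ?k * u a * u a'"
        proof -
          have "real (card S) ^ N \<noteq> 0" using S AS A by (auto simp: card_eq_0_iff)
          then have cc: "(cmod c)\<^sup>2 = fact N / real (card S) ^ N" using c by (simp add: field_simps)
          have pk: "p ?k = fact N / (fact ?k * fact (N - ?k)) * real (card A) ^ ?k * real (card ?B) ^ (N - ?k) / real (card S) ^ N"
            using k by (simp add: p_def binomial_fact)
          have uu: "u a * u a' = weight A a * weight A a' * (fact ?k / real (card A) ^ ?k)"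
          proof -
            define s where "s = sqrt (fact ?k / real (card A) ^ ?k)"
            have "u a = weight A a * s" "u a' = weight A a' * s" using k by (simp_all add: u_def s_def)
            then have "u a * u a' = weight A a * weight A a' * (s * s)" by (simp only: mult_ac)
            then show ?thesis by (simp add: s_def)
          qed
          have "p ?k * u a * u a' = p ?k * (u a * u a')" by simp
          then show ?thesis unfolding cc pk uu using mA by (simp add: field_simps)
        qed
        finally show ?thesis using True k by (simp add: block_kernel_def)
      qed
    qed
  qed
qed

subsection \<open>Stirling's formula\<close>

lemma DERIV_sign_change_minimum:
  fixes f f' :: "real \<Rightarrow> real"
  assumes D: "\<And>x. x > -1 \<Longrightarrow> (f has_real_derivative f' x) (at x)"
    and neg: "\<And>x. -1 < x \<Longrightarrow> x \<le> 0 \<Longrightarrow> f' x \<le> 0" and pos: "\<And>x. x \<ge> 0 \<Longrightarrow> f' x \<ge> 0"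
    and "x > -1"
  shows "f 0 \<le> f x"
proof (cases "x \<ge> 0")
  case True
  then show ?thesis
    by (rule DERIV_nonneg_imp_nondecreasing) (use D pos in force)
next
  case False
  then have "x \<le> 0" by simp
  then show ?thesis
    by (rule DERIV_nonpos_imp_nonincreasing) (use D neg \<open>x > -1\<close> in force)
qed

text \<open>The difference of the two sides has derivative \<open>x^3 / (1 + x)\<close>, which has
  the sign of \<open>x\<close>; an odd truncation of the series therefore bounds from above on both
  sides of 0.\<close>

lemma ln_one_plus_le_cubic:
  fixes x :: real
  assumes "x > -1"
  shows "ln (1 + x) \<le> x - x^2 / 2 + x^3 / 3"
proof -
  let ?f = "\<lambda>x::real. x - x^2 / 2 + x^3 / 3 - ln (1 + x)"
  have "?f 0 \<le> ?f x"
  proof (rule DERIV_sign_change_minimum[where f' = "\<lambda>x. x^3 / (1 + x)"])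
    fix x :: real assume "x > -1"
    then show "(?f has_real_derivative x^3 / (1 + x)) (at x)"
      by (auto intro!: derivative_eq_intros simp: field_simps power2_eq_square power3_eq_cube)
  qed (use assms in \<open>auto intro!: divide_nonpos_nonneg simp: zero_le_power_eq power_le_zero_eq\<close>)
  then show ?thesis by simp
qed

text \<open>This expression is the derivative of the gap in the lower bound for
  \<open>(1 + x) * ln (1 + x)\<close>, so its sign change at 0 places the minimum of that gap
  there.\<close>

lemma ln_one_plus_minus_quadratic_sgn:
  fixes x :: real
  assumes "x > -1"
  shows "x \<ge> 0 \<Longrightarrow> ln (1 + x) - x + x^2 / 2 \<ge> 0" and "x \<le> 0 \<Longrightarrow> ln (1 + x) - x + x^2 / 2 \<le> 0"
proof -
  let ?f = "\<lambda>x::real. ln (1 + x) - x + x^2 / 2"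
  have D: "(?f has_real_derivative x^2 / (1 + x)) (at x)" if "x > -1" for x :: real
    using that by (auto intro!: derivative_eq_intros simp: field_simps power2_eq_square)
  show "?f x \<ge> 0" if "x \<ge> 0"
  proof -
    have "?f 0 \<le> ?f x" using that
      by (rule DERIV_nonneg_imp_nondecreasing) (use D in \<open>force intro!: divide_nonneg_nonneg\<close>)
    then show ?thesis by simp
  qed
  show "?f x \<le> 0" if "x \<le> 0"
  proof -
    have "?f x \<le> ?f 0" using that
    proof (rule DERIV_nonneg_imp_nondecreasing)
      fix z assume "x \<le> z"
      then have "z > -1" using assms by simp
      then have "z^2 / (1 + z) \<ge> 0" by simp
      then show "\<exists>y. (?f has_real_derivative y) (at z) \<and> 0 \<le> y"
        using D[OF \<open>z > -1\<close>] by blast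
    qed
    then show ?thesis by simp
  qed
qed

text \<open>Both bounds share the terms up to third order. In a symmetric mean the odd ones
  disappear, and only the variance and a fourth-moment error remain.\<close>

lemma x_ln_x_bounds:
  fixes x :: real
  assumes "x > -1"
  shows "x + x^2 / 2 - x^3 / 6 \<le> (1 + x) * ln (1 + x)"
    and "(1 + x) * ln (1 + x) \<le> x + x^2 / 2 - x^3 / 6 + x^4 / 3"
proof -
  let ?f = "\<lambda>x::real. (1 + x) * ln (1 + x) - (x + x^2 / 2 - x^3 / 6)"
  have "?f 0 \<le> ?f x"
  proof (rule DERIV_sign_change_minimum[where f' = "\<lambda>x. ln (1 + x) - x + x^2 / 2"])
    fix x :: real assume "x > -1"
    then have "(?f has_real_derivative ln (1 + x) + (1 + x) * (1 / (1 + x)) - (1 + x - x^2 / 2)) (at x)"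
      by (auto intro!: derivative_eq_intros simp: power2_eq_square)
    moreover have "ln (1 + x) + (1 + x) * (1 / (1 + x)) - (1 + x - x^2 / 2) = ln (1 + x) - x + x^2 / 2"
      using \<open>x > -1\<close> by simp
    ultimately show "(?f has_real_derivative ln (1 + x) - x + x^2 / 2) (at x)" by metis
  qed (use ln_one_plus_minus_quadratic_sgn assms in auto)
  then show "x + x^2 / 2 - x^3 / 6 \<le> (1 + x) * ln (1 + x)" by simp
  have "(1 + x) * ln (1 + x) \<le> (1 + x) * (x - x^2 / 2 + x^3 / 3)"
    using ln_one_plus_le_cubic[OF assms] assms by (intro mult_left_mono) auto
  also have "\<dots> = x + x^2 / 2 - x^3 / 6 + x^4 / 3"
    by (simp add: field_simps power2_eq_square power3_eq_cube power4_eq_xxxx)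
  finally show "(1 + x) * ln (1 + x) \<le> x + x^2 / 2 - x^3 / 6 + x^4 / 3" .
qed

text \<open>The left side is a Pade approximant; at \<open>u = 1 / y\<close> it equals
  \<open>1 / (y + 1/2)\<close>, exactly what makes successive Stirling remainders decrease.\<close>

lemma ln_one_plus_ge_pade:
  fixes u :: real
  assumes "u \<ge> 0"
  shows "2 * u / (2 + u) \<le> ln (1 + u)"
proof -
  let ?f = "\<lambda>u::real. ln (1 + u) - 2 * u / (2 + u)"
  have "?f 0 \<le> ?f u" using assms
  proof (rule DERIV_nonneg_imp_nondecreasing)
    fix x :: real assume "0 \<le> x" 
    then have "(?f has_real_derivative 1 / (1 + x) - (2 * (2 + x) - 2 * x) / (2 + x)^2) (at x)"
      by (auto intro!: derivative_eq_intros simp: power2_eq_square)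
    moreover have "1 / (1 + x) - (2 * (2 + x) - 2 * x) / (2 + x)^2 = x^2 / ((1 + x) * (2 + x)^2)"
      using \<open>0 \<le> x\<close> by (simp add: divide_simps) (simp add: algebra_simps power2_eq_square)
    ultimately have "(?f has_real_derivative x^2 / ((1 + x) * (2 + x)^2)) (at x)" by simp
    then show "\<exists>y. (?f has_real_derivative y) (at x) \<and> 0 \<le> y"
      using \<open>0 \<le> x\<close> by force
  qed
  then show ?thesis by simp
qed

lemma stirling_step_bounds:
  fixes y :: real
  assumes "y \<ge> 1"
  shows "1 \<le> (y + 1/2) * ln (1 + 1 / y)" and "(y + 1/2) * ln (1 + 1 / y) \<le> 1 + 1 / (4 * y^2)"
proof -
  have "1 = (y + 1/2) * (2 * (1 / y) / (2 + 1 / y))"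
    using assms by (simp add: field_simps)
  also have "\<dots> \<le> (y + 1/2) * ln (1 + 1 / y)"
    using assms by (intro mult_left_mono ln_one_plus_ge_pade) auto
  finally show "1 \<le> (y + 1/2) * ln (1 + 1 / y)" .
  have "-1 < 1 / y" using assms by (smt (verit) divide_pos_pos)
  then have "(y + 1/2) * ln (1 + 1 / y) \<le> (y + 1/2) * (1 / y - (1 / y)^2 / 2 + (1 / y)^3 / 3)"
    using assms by (intro mult_left_mono ln_one_plus_le_cubic) auto
  also have "\<dots> = 1 + 1 / (12 * y^2) + (1 / (6 * y^2)) * (1 / y)"
    using assms by (simp add: field_simps power2_eq_square power3_eq_cube)
  also have "\<dots> \<le> 1 + 1 / (12 * y^2) + (1 / (6 * y^2)) * 1"
    using assms by (intro add_left_mono mult_left_mono) auto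
  also have "\<dots> = 1 + 1 / (4 * y^2)"
    using assms by (simp add: field_simps)
  finally show "(y + 1/2) * ln (1 + 1 / y) \<le> 1 + 1 / (4 * y^2)" .
qed

section \<open>The remainder in Stirling's formula and its limit\<close>

definition stirling_rest :: "nat \<Rightarrow> real" where
  "stirling_rest n = ln (fact n) - ((real n + 1/2) * ln (real n) - real n)"

text \<open>The remainder decreases, but increases once \<open>1 / (2 * n)\<close> is subtracted,
  because each step is at most \<open>1 / (4 * n^2)\<close>, and this is at most the telescoping
  difference \<open>1 / (2 * n) - 1 / (2 * (n + 1))\<close>. The two monotone sequences enclose the
  limit.\<close>

lemma stirling_rest_step:
  assumes "n \<ge> 1"
  shows "stirling_rest (Suc n) \<le> stirling_rest n"
    and "stirling_rest n - 1 / (2 * real n) \<le> stirling_rest (Suc n) - 1 / (2 * real (Suc n))"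
proof -
  have n: "real n \<ge> 1" using assms by simp
  have "1 + real n = real n * (1 + 1 / real n)" "1 + 1 / real n > 0"
    using n by (simp_all add: field_simps add_pos_pos)
  then have "ln (1 + real n) = ln (real n) + ln (1 + 1 / real n)"
    using n ln_mult[of "real n" "1 + 1 / real n"] by simp
  moreover have "ln (fact (Suc n)) = ln (1 + real n) + ln (fact n)"
    using ln_mult[of "1 + real n" "fact n"] by simp
  ultimately have eq: "stirling_rest n - stirling_rest (Suc n) = (real n + 1/2) * ln (1 + 1 / real n) - 1"
    unfolding stirling_rest_def by (simp add: algebra_simps del: fact_Suc)
  from eq stirling_step_bounds(1)[OF n] show "stirling_rest (Suc n) \<le> stirling_rest n" by simp
  have "1 / (4 * (real n)^2) \<le> 1 / (2 * real n) - 1 / (2 * real (Suc n))"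
    using n by (simp add: divide_simps) (simp add: power2_eq_square algebra_simps)
  with eq stirling_step_bounds(2)[OF n]
  show "stirling_rest n - 1 / (2 * real n) \<le> stirling_rest (Suc n) - 1 / (2 * real (Suc n))" by linarith
qed

lemma wallis_product_closed_form:
  "(\<Prod>k=1..n. (4 * real k ^ 2) / (4 * real k ^ 2 - 1))
     = 2 ^ (4 * n) * fact n ^ 4 / (fact (2 * n) ^ 2 * (2 * real n + 1))"
proof (induction n)
  case (Suc n)
  have "2 * Suc n = Suc (Suc (2 * n))" "4 * Suc n = 4 * n + 4" by auto
  then have f: "fact (2 * Suc n) = (2 * real n + 2) * (2 * real n + 1) * fact (2 * n)"
    and p: "(2::real) ^ (4 * Suc n) = 2 ^ (4 * n) * 16" 
    by (simp_all add: algebra_simps power_add)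
  have ne: "4 * real (Suc n) ^ 2 - 1 = (2 * real n + 1) * (2 * real n + 3)"
    by (simp add: power2_eq_square algebra_simps)
  have nz: "2 * real n + 1 \<noteq> 0" "2 * real n + 3 \<noteq> 0" "real n + 1 \<noteq> 0" "2 * real n + 2 \<noteq> 0"
    by (simp_all add: add_nonneg_eq_0_iff)
  have "(\<Prod>k=1..Suc n. (4 * real k ^ 2) / (4 * real k ^ 2 - 1)) =
     2 ^ (4 * n) * fact n ^ 4 / (fact (2 * n) ^ 2 * (2 * real n + 1)) *
       ((4 * (real n + 1) ^ 2) / ((2 * real n + 1) * (2 * real n + 3)))"
    using Suc.IH ne by (simp add: add.commute)
  also have "\<dots> = 2 ^ (4 * Suc n) * fact (Suc n) ^ 4 / (fact (2 * Suc n) ^ 2 * (2 * real (Suc n) + 1))"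
  proof -
    have s: "2 * real (Suc n) + 1 = 2 * real n + 3" "fact (Suc n) = (real n + 1) * fact n"
      "2 * real n + 2 = 2 * (real n + 1)" by simp_all
    show ?thesis unfolding f p s(1,2) unfolding s(3) using nz
      by (simp add: divide_simps) (simp add: power4_eq_xxxx power2_eq_square algebra_simps)
  qed
  finally show ?case .
qed simp

text \<open>Monotonicity gives some limit \<open>L\<close>. In
  \<open>4 * stirling_rest n - 2 * stirling_rest (2 * n)\<close> the terms \<open>n ln n\<close> and
  \<open>n\<close> cancel, and what is left is the logarithm of the Wallis product, whose limit
  \<open>pi / 2\<close> identifies \<open>L\<close>.\<close>

lemma stirling_rest_tendsto: "stirling_rest \<longlonglongrightarrow> ln (2 * pi) / 2"
proof -
  let ?s = "\<lambda>n. stirling_rest (Suc n)"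
  have dec: "decseq ?s" by (intro decseq_SucI stirling_rest_step) simp
  have inc: "incseq (\<lambda>n. ?s n - 1 / (2 * real (Suc n)))"
    by (intro incseq_SucI stirling_rest_step) simp
  have "?s n \<ge> stirling_rest 1 - 1/2" for n
  proof -
    have "stirling_rest 1 - 1/2 \<le> ?s n - 1 / (2 * real (Suc n))"
      using incseqD[OF inc, of 0 n] by simp
    also have "\<dots> \<le> ?s n" by simp
    finally show ?thesis .
  qed
  then obtain L where "?s \<longlonglongrightarrow> L" using decseq_convergent[OF dec] by metis
  then have L: "stirling_rest \<longlonglongrightarrow> L" by (simp add: filterlim_sequentially_Suc)
  have "strict_mono (\<lambda>n::nat. 2 * n)" by (simp add: strict_mono_def)
  from LIMSEQ_subseq_LIMSEQ[OF L this] have L2: "(\<lambda>n. stirling_rest (2 * n)) \<longlonglongrightarrow> L"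
    by (simp add: o_def)
  let ?W = "\<lambda>n. \<Prod>k=1..n. (4 * real k ^ 2) / (4 * real k ^ 2 - 1)"
  have "(\<lambda>n. ln (?W n)) \<longlonglongrightarrow> ln (pi / 2)"
    by (rule tendsto_ln[OF wallis]) simp
  moreover have "\<forall>\<^sub>F n in sequentially.
     4 * stirling_rest n - 2 * stirling_rest (2 * n) - ln 2 - ln (2 + 1 / real n) = ln (?W n)"
    using eventually_ge_at_top[of 1]
  proof eventually_elim
    case (elim n)
    then have n: "real n > 0" by simp
    have "2 + 1 / real n = (2 * real n + 1) / real n" using n by (simp add: field_simps)
    then have "ln (2 + 1 / real n) = ln (2 * real n + 1) - ln (real n)"
      using n by (simp add: ln_div add_pos_pos)
    moreover have "ln (?W n) = 4 * real n * ln 2 + 4 * ln (fact n) - (2 * ln (fact (2 * n)) + ln (2 * real n + 1))"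
      unfolding wallis_product_closed_form using n
      by (simp add: ln_div ln_mult ln_realpow add_pos_pos)
    moreover have "ln (real (2 * n)) = ln 2 + ln (real n)" using n by (simp add: ln_mult)
    ultimately show ?case unfolding stirling_rest_def
      by (simp add: field_simps)
  qed
  ultimately have "(\<lambda>n. 4 * stirling_rest n - 2 * stirling_rest (2 * n) - ln 2 - ln (2 + 1 / real n))
      \<longlonglongrightarrow> ln (pi / 2)"
    by (simp add: tendsto_cong)
  moreover have "(\<lambda>n. 4 * stirling_rest n - 2 * stirling_rest (2 * n) - ln 2 - ln (2 + 1 / real n))
      \<longlonglongrightarrow> 4 * L - 2 * L - ln 2 - ln (2 + 0)"
    by (intro tendsto_intros L L2 lim_const_over_n) simp
  ultimately have "4 * L - 2 * L - ln 2 - ln (2 + 0) = ln (pi / 2)"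
    by (rule LIMSEQ_unique[rotated])
  then have "L = ln (2 * pi) / 2" by (simp add: ln_div ln_mult)
  with L show ?thesis by simp
qed

lemma stirling_rest_bounds:
  assumes "n \<ge> 1"
  shows "ln (2 * pi) / 2 \<le> stirling_rest n" and "stirling_rest n \<le> ln (2 * pi) / 2 + 1 / (2 * real n)"
proof -
  let ?s = "\<lambda>n. stirling_rest (Suc n)"
  obtain k where k: "n = Suc k" using assms by (cases n) auto
  have L: "?s \<longlonglongrightarrow> ln (2 * pi) / 2"
    using stirling_rest_tendsto by (simp add: filterlim_sequentially_Suc)
  have "decseq ?s" by (intro decseq_SucI stirling_rest_step) simp
  from decseq_ge[OF this L] show "ln (2 * pi) / 2 \<le> stirling_rest n" by (simp add: k)
  have inc: "incseq (\<lambda>n. ?s n - 1 / 2 * (1 / real (Suc n)))"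
    by (intro incseq_SucI) (use stirling_rest_step(2) in force)
  have "(\<lambda>n. ?s n - 1 / 2 * (1 / real (Suc n))) \<longlonglongrightarrow> ln (2 * pi) / 2 - 1 / 2 * 0"
    using lim_const_over_n[of "1::real", THEN LIMSEQ_Suc] by (intro tendsto_intros L) simp
  from incseq_le[OF inc this, of k] show "stirling_rest n \<le> ln (2 * pi) / 2 + 1 / (2 * real n)"
    by (simp add: k)
qed

subsection \<open>The entropy of the symmetric binomial distribution\<close>

definition binomial_mean :: "nat \<Rightarrow> (nat \<Rightarrow> real) \<Rightarrow> real" where
  "binomial_mean N f = (\<Sum>k\<le>N. real (N choose k) / 2 ^ N * f k)"

text \<open>Pascal's rule, read as conditioning on one more toss of a fair coin.\<close>

lemma binomial_mean_Suc:
  "binomial_mean (Suc N) f = (binomial_mean N f + binomial_mean N (\<lambda>k. f (Suc k))) / 2"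
proof -
  have "(\<Sum>k\<le>Suc N. real (Suc N choose k) * f k)
     = f 0 + (\<Sum>k\<le>N. real (N choose Suc k) * f (Suc k)) + (\<Sum>k\<le>N. real (N choose k) * f (Suc k))"
    by (simp only: sum.atMost_Suc_shift) (simp add: algebra_simps sum.distrib)
  also have "f 0 + (\<Sum>k\<le>N. real (N choose Suc k) * f (Suc k)) = (\<Sum>k\<le>Suc N. real (N choose k) * f k)"
    by (simp only: sum.atMost_Suc_shift) simp
  also have "\<dots> = (\<Sum>k\<le>N. real (N choose k) * f k)" by simp
  finally have *: "(\<Sum>k\<le>Suc N. real (Suc N choose k) * f k)
     = (\<Sum>k\<le>N. real (N choose k) * f k) + (\<Sum>k\<le>N. real (N choose k) * f (Suc k))" .
  have div: "binomial_mean M g = (\<Sum>k\<le>M. real (M choose k) * g k) / 2 ^ M" for M g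
    by (simp add: binomial_mean_def sum_divide_distrib)
  show ?thesis unfolding div * by (simp add: field_simps)
qed

lemma binomial_mean_add: "binomial_mean N (\<lambda>k. f k + g k) = binomial_mean N f + binomial_mean N g"
  by (simp add: binomial_mean_def distrib_left sum.distrib)

lemma binomial_mean_diff: "binomial_mean N (\<lambda>k. f k - g k) = binomial_mean N f - binomial_mean N g"
  by (simp add: binomial_mean_def right_diff_distrib sum_subtractf)

lemma binomial_mean_cmult: "binomial_mean N (\<lambda>k. c * f k) = c * binomial_mean N f"
  by (simp add: binomial_mean_def sum_distrib_left algebra_simps)

lemma binomial_mean_divide: "binomial_mean N (\<lambda>k. f k / c) = binomial_mean N f / c"
  by (simp add: binomial_mean_def sum_divide_distrib)

lemma binomial_mean_const [simp]: "binomial_mean N (\<lambda>k. c) = c"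
  by (induction N) (simp_all add: binomial_mean_Suc, simp add: binomial_mean_def)

lemmas binomial_mean_linear =
  binomial_mean_add binomial_mean_diff binomial_mean_cmult binomial_mean_divide

lemma binomial_mean_mono:
  "(\<And>k. k \<le> N \<Longrightarrow> f k \<le> g k) \<Longrightarrow> binomial_mean N f \<le> binomial_mean N g"
  unfolding binomial_mean_def by (intro sum_mono mult_left_mono) auto

lemma binomial_mean_reflect: "binomial_mean N (\<lambda>k. f (N - k)) = binomial_mean N f"
  unfolding binomial_mean_def
  by (rule sum.reindex_bij_witness[of _ "\<lambda>k. N - k" "\<lambda>k. N - k"]) (auto simp: binomial_symmetric[symmetric])

text \<open>The variable \<open>2 * k - N\<close> is a sum of \<open>N\<close> random signs, so one
  more toss shifts it by 1 up or down. The moments are proved jointly since each recursion involves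
  lower ones of the same parity.\<close>

lemma binomial_central_moments:
  shows "binomial_mean N (\<lambda>k. (2 * real k - real N) ^ 1) = 0"
    and "binomial_mean N (\<lambda>k. (2 * real k - real N) ^ 2) = real N"
    and "binomial_mean N (\<lambda>k. (2 * real k - real N) ^ 3) = 0"
    and "binomial_mean N (\<lambda>k. (2 * real k - real N) ^ 4) = 3 * real N ^ 2 - 2 * real N"
proof -
  let ?M = "\<lambda>N j. binomial_mean N (\<lambda>k. (2 * real k - real N) ^ j)"
  have "?M N 1 = 0 \<and> ?M N 2 = real N \<and> ?M N 3 = 0 \<and> ?M N 4 = 3 * real N ^ 2 - 2 * real N"
  proof (induction N)
    case (Suc N)
    have step: "?M (Suc N) j = binomial_mean N
        (\<lambda>k. (((2 * real k - real N) - 1) ^ j + ((2 * real k - real N) + 1) ^ j) / 2)" for j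
      by (simp add: binomial_mean_Suc binomial_mean_linear algebra_simps)
    have e: "((d - 1) ^ 1 + (d + 1) ^ 1) / 2 = d ^ 1" "((d - 1) ^ 2 + (d + 1) ^ 2) / 2 = d ^ 2 + 1"
      "((d - 1) ^ 3 + (d + 1) ^ 3) / 2 = d ^ 3 + 3 * d ^ 1"
      "((d - 1) ^ 4 + (d + 1) ^ 4) / 2 = d ^ 4 + 6 * d ^ 2 + 1" for d :: real
      by (simp_all add: field_simps power2_eq_square power3_eq_cube power4_eq_xxxx)
    show ?case unfolding step e
      using Suc.IH by (simp add: binomial_mean_linear del: power_one_right)
        (simp add: power2_eq_square algebra_simps)
  qed (simp add: binomial_mean_def)
  then show "?M N 1 = 0" "?M N 2 = real N" "?M N 3 = 0" "?M N 4 = 3 * real N ^ 2 - 2 * real N"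
    by auto
qed

text \<open>The factor \<open>1 / (k + 1)\<close> is absorbed by
  \<open>(N choose k) / (k + 1) = (Suc N choose Suc k) / (N + 1)\<close>, and a full row of Pascal's
  triangle sums to \<open>2 ^ Suc N\<close>.\<close>

lemma binomial_mean_inverse_Suc: "binomial_mean N (\<lambda>k. 1 / (real k + 1)) \<le> 2 / (real N + 1)"
proof -
  have "(\<Sum>k\<le>N. real (N choose k) / 2 ^ N * (1 / (real k + 1)))
     = (\<Sum>k\<le>N. real (Suc N choose Suc k) / (2 ^ N * (real N + 1)))"
  proof (rule sum.cong)
    fix k
    have "(real k + 1) * real (Suc N choose Suc k) = (real N + 1) * real (N choose k)"
      using arg_cong[OF Suc_times_binomial[of k N], of real] by (simp add: algebra_simps)
    then show "real (N choose k) / 2 ^ N * (1 / (real k + 1)) = real (Suc N choose Suc k) / (2 ^ N * (real N + 1))"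
      by (simp add: divide_simps del: binomial_Suc_Suc) (simp add: algebra_simps)
  qed simp
  also have "\<dots> \<le> (\<Sum>k\<le>Suc N. real (Suc N choose k) / (2 ^ N * (real N + 1)))"
    by (subst sum.atMost_Suc_shift) simp
  also have "\<dots> = real (\<Sum>k\<le>Suc N. Suc N choose k) / (2 ^ N * (real N + 1))"
    by (simp only: of_nat_sum sum_divide_distrib)
  also have "\<dots> = 2 / (real N + 1)"
    by (subst choose_row_sum) simp
  finally show ?thesis by (simp add: binomial_mean_def)
qed

lemma binomial_mean_ln_fact:
  assumes "m \<ge> 1"
  shows "\<bar>binomial_mean (2 * m) (\<lambda>k. ln (fact k))
    - ((real m + 1/2) * ln (real m + 1) + 1/4 - (real m + 1) + ln (2 * pi) / 2)\<bar> \<le> 1 / real m"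
proof -
  let ?E = "binomial_mean (2 * m)"
  \<comment> \<open>\<open>\<mu>\<close> is the mean of \<open>K + 1\<close> and \<open>x\<close>
    the relative deviation from it: \<open>K + 1 = \<mu> * (1 + x)\<close>, with
    \<open>x > -1\<close> because \<open>K + 1\<close> is positive.\<close>
  define \<mu> where "\<mu> = real m + 1"
  define x where "x k = (2 * real k - real (2 * m)) / (2 * \<mu>)" for k
  have m: "real m \<ge> 1" using assms by simp
  have \<mu>: "\<mu> > 0" by (simp add: \<mu>_def)
  have y: "real k + 1 = \<mu> * (1 + x k)" for k
    using \<mu> by (simp add: x_def field_simps) (simp add: \<mu>_def algebra_simps)
  have x1: "x k > -1" for k
  proof -
    have "\<mu> * (1 + x k) > 0" using y[of k] by linarith
    with \<mu> show ?thesis by (simp add: zero_less_mult_iff)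
  qed
  have ln_y: "ln (real k + 1) = ln \<mu> + ln (1 + x k)" for k
    unfolding y[of k] using \<mu> x1[of k] by (simp add: ln_mult_pos)
  have mean_x: "?E (\<lambda>k. x k ^ j) = ?E (\<lambda>k. (2 * real k - real (2 * m)) ^ j) / (2 * \<mu>) ^ j" for j
    by (simp add: x_def power_divide binomial_mean_divide)
  have X1: "?E (\<lambda>k. x k) = 0" using mean_x[of 1] binomial_central_moments(1)[of "2 * m"] by simp
  have X2: "?E (\<lambda>k. x k ^ 2) = real m / (2 * \<mu> ^ 2)"
    unfolding mean_x binomial_central_moments by (simp add: power_mult_distrib)
  have X3: "?E (\<lambda>k. x k ^ 3) = 0" unfolding mean_x binomial_central_moments by simp
  have X4: "?E (\<lambda>k. x k ^ 4) \<le> 3 * real m ^ 2 / (4 * \<mu> ^ 4)"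
    unfolding mean_x binomial_central_moments using \<mu> by (simp add: divide_simps power_mult_distrib)
  have Einv: "?E (\<lambda>k. 1 / (real k + 1)) \<le> 2 / (2 * real m + 1)"
    using binomial_mean_inverse_Suc[of "2 * m"] by simp

  \<comment> \<open>The constant \<open>1/4\<close> is the limit of \<open>\<mu>\<close> times half
    the variance \<open>m / (2 * \<mu> ^ 2)\<close> of \<open>x\<close>.\<close>
  have ylny: "\<bar>?E (\<lambda>k. (real k + 1) * ln (real k + 1)) - (\<mu> * ln \<mu> + 1/4)\<bar> \<le> 1 / (4 * real m)"
  proof -
    have split: "(real k + 1) * ln (real k + 1) = \<mu> * ln \<mu> + \<mu> * ln \<mu> * x k + \<mu> * ((1 + x k) * ln (1 + x k))" for k
      unfolding ln_y unfolding y[of k] by (simp add: algebra_simps)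
    have "?E (\<lambda>k. (real k + 1) * ln (real k + 1)) = \<mu> * ln \<mu> + \<mu> * ?E (\<lambda>k. (1 + x k) * ln (1 + x k))"
      unfolding split by (simp add: binomial_mean_linear X1)
    moreover have "?E (\<lambda>k. x k + x k ^ 2 / 2 - x k ^ 3 / 6) \<le> ?E (\<lambda>k. (1 + x k) * ln (1 + x k))"
      by (intro binomial_mean_mono x_ln_x_bounds x1)
    then have "\<mu> * (real m / (4 * \<mu> ^ 2)) \<le> \<mu> * ?E (\<lambda>k. (1 + x k) * ln (1 + x k))"
      using \<mu> by (intro mult_left_mono) (auto simp: binomial_mean_linear X1 X2 X3)
    moreover have "?E (\<lambda>k. (1 + x k) * ln (1 + x k)) \<le> ?E (\<lambda>k. x k + x k ^ 2 / 2 - x k ^ 3 / 6 + x k ^ 4 / 3)"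
      by (intro binomial_mean_mono x_ln_x_bounds x1)
    then have "\<mu> * ?E (\<lambda>k. (1 + x k) * ln (1 + x k)) \<le> \<mu> * (real m / (4 * \<mu> ^ 2) + real m ^ 2 / (4 * \<mu> ^ 4))"
      using \<mu> X4 by (intro mult_left_mono) (auto simp: binomial_mean_linear X1 X2 X3)
    moreover have "\<mu> * (real m / (4 * \<mu> ^ 2)) \<ge> 1/4 - 1 / (4 * real m)"
    proof -
      have "\<mu> * (real m / (4 * \<mu> ^ 2)) = real m / (4 * \<mu>)" using \<mu> by (simp add: power2_eq_square)
      also have "\<dots> = 1/4 - 1 / (4 * \<mu>)" using \<mu> by (simp add: field_simps) (simp add: \<mu>_def)
      also have "\<dots> \<ge> 1/4 - 1 / (4 * real m)" using m \<mu> by (simp add: \<mu>_def frac_le)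
      finally show ?thesis .
    qed
    moreover have "\<mu> * (real m / (4 * \<mu> ^ 2) + real m ^ 2 / (4 * \<mu> ^ 4)) \<le> 1/4 + 1 / (4 * real m)"
    proof -
      have "\<mu> * (real m / (4 * \<mu> ^ 2) + real m ^ 2 / (4 * \<mu> ^ 4)) = real m / (4 * \<mu>) + (real m ^ 2 / \<mu> ^ 2) * (1 / (4 * \<mu>))"
        using \<mu> by (simp add: power2_eq_square power4_eq_xxxx field_simps)
      also have "\<dots> \<le> 1 / 4 + 1 * (1 / (4 * real m))"
      proof (intro add_mono mult_mono)
        show "real m ^ 2 / \<mu> ^ 2 \<le> 1"
          using m by (simp add: \<mu>_def power_mono divide_le_eq_1)
      qed (use m in \<open>auto simp: \<mu>_def field_simps\<close>)
      finally show ?thesis by simp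
    qed
    ultimately show ?thesis by linarith
  qed

  \<comment> \<open>Above, \<open>ln (1 + x) \<le> x\<close> has mean 0. Below,
    \<open>ln (1 + x) \<ge> 1 - 1 / (1 + x)\<close> reduces to the mean of
    \<open>\<mu> / (K + 1)\<close>, which exceeds 1 by at most \<open>1 / (2 * m)\<close>.\<close>
  have lny: "?E (\<lambda>k. ln (real k + 1)) \<le> ln \<mu>" "?E (\<lambda>k. ln (real k + 1)) \<ge> ln \<mu> - 1 / (2 * real m)"
  proof -
    have "?E (\<lambda>k. ln \<mu> + ln (1 + x k)) \<le> ?E (\<lambda>k. ln \<mu> + x k)"
      by (intro binomial_mean_mono add_left_mono ln_add_one_self_le_self2 x1)
    then show "?E (\<lambda>k. ln (real k + 1)) \<le> ln \<mu>" unfolding ln_y by (simp add: binomial_mean_linear X1)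
    have low: "ln (1 + x k) \<ge> 1 - \<mu> * (1 / (real k + 1))" for k
    proof -
      have "- ln (1 + x k) = ln (1 / (1 + x k))" using x1[of k] by (simp add: ln_div)
      also have "\<dots> \<le> 1 / (1 + x k) - 1" using x1[of k] by (intro ln_le_minus_one) simp
      also have "1 / (1 + x k) = \<mu> * (1 / (real k + 1))" unfolding y[of k] using \<mu> by simp
      finally show ?thesis by simp
    qed
    have "?E (\<lambda>k. ln \<mu> + (1 - \<mu> * (1 / (real k + 1)))) \<le> ?E (\<lambda>k. ln \<mu> + ln (1 + x k))"
      by (intro binomial_mean_mono add_left_mono low)
    then have "ln \<mu> + (1 - \<mu> * ?E (\<lambda>k. 1 / (real k + 1))) \<le> ?E (\<lambda>k. ln (real k + 1))"
      unfolding ln_y binomial_mean_add binomial_mean_diff binomial_mean_cmult binomial_mean_const .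
    moreover have "\<mu> * ?E (\<lambda>k. 1 / (real k + 1)) \<le> \<mu> * (2 / (2 * real m + 1))"
      using Einv \<mu> by (intro mult_left_mono) auto
    moreover have "\<mu> * (2 / (2 * real m + 1)) \<le> 1 + 1 / (2 * real m)"
      using m by (simp add: \<mu>_def field_simps)
    ultimately show "?E (\<lambda>k. ln (real k + 1)) \<ge> ln \<mu> - 1 / (2 * real m)" by linarith
  qed

  \<comment> \<open>Stirling's formula is applied to \<open>(k + 1)!\<close>; removing the factor
    \<open>k + 1\<close> lowers the coefficient of the logarithm from \<open>k + 3/2\<close> to
    \<open>(k + 1) - 1/2\<close>.\<close>
  have fact_eq: "ln (fact k) = ((real k + 1) * ln (real k + 1) - 1/2 * ln (real k + 1) - (real k + 1)) + stirling_rest (Suc k)" for k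
  proof -
    have "ln (fact (Suc k)) = ln (real k + 1) + ln (fact k)"
      using ln_mult[of "real k + 1" "fact k"] by (simp add: add.commute)
    then show ?thesis unfolding stirling_rest_def by (simp add: algebra_simps del: fact_Suc)
  qed
  have Ek: "?E (\<lambda>k. real k + 1) = \<mu>"
    unfolding y by (simp add: binomial_mean_linear X1)
  have ET: "?E (\<lambda>k. ln (fact k)) = ?E (\<lambda>k. (real k + 1) * ln (real k + 1)) - 1/2 * ?E (\<lambda>k. ln (real k + 1))
      - \<mu> + ?E (\<lambda>k. stirling_rest (Suc k))"
    unfolding fact_eq binomial_mean_add[of _ "\<lambda>k. _ k - _ k - _ k"] binomial_mean_diff binomial_mean_cmult Ek ..
  have "?E (\<lambda>k. ln (2 * pi) / 2) \<le> ?E (\<lambda>k. stirling_rest (Suc k))"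
    by (intro binomial_mean_mono stirling_rest_bounds) simp
  then have r1: "ln (2 * pi) / 2 \<le> ?E (\<lambda>k. stirling_rest (Suc k))" by (simp only: binomial_mean_const)
  have "?E (\<lambda>k. stirling_rest (Suc k)) \<le> ?E (\<lambda>k. ln (2 * pi) / 2 + 1/2 * (1 / (real k + 1)))"
    using stirling_rest_bounds(2) by (intro binomial_mean_mono) (force simp: algebra_simps)
  also have "\<dots> = ln (2 * pi) / 2 + 1/2 * ?E (\<lambda>k. 1 / (real k + 1))"
    by (simp only: binomial_mean_add binomial_mean_cmult binomial_mean_const)
  also have "\<dots> \<le> ln (2 * pi) / 2 + 1 / (2 * real m)"
  proof -
    have "2 / (2 * real m + 1) \<le> 1 / real m" using m by (simp add: field_simps)
    with Einv have "?E (\<lambda>k. 1 / (real k + 1)) \<le> 1 / real m" by linarith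
    moreover have "1 / (2 * real m) = 1/2 * (1 / real m)" by simp
    ultimately show ?thesis by linarith
  qed
  finally have r2: "?E (\<lambda>k. stirling_rest (Suc k)) \<le> ln (2 * pi) / 2 + 1 / (2 * real m)" .
  \<comment> \<open>The three errors are \<open>1 / (4 * m)\<close>, half of
    \<open>1 / (2 * m)\<close>, and \<open>1 / (2 * m)\<close>; together they make
    \<open>1 / m\<close>.\<close>
  have "(real m + 1/2) * ln (real m + 1) = \<mu> * ln \<mu> - 1/2 * ln \<mu>"
    by (simp add: \<mu>_def algebra_simps)
  moreover have "1 / (2 * real m) = 1 / real m / 2" "1 / (4 * real m) = 1 / real m / 4" by simp_all
  ultimately show ?thesis
    using ET ylny lny r1 r2 unfolding \<mu>_def[symmetric] by linarith
qed

text \<open>By the symmetry \<open>k \<mapsto> N - k\<close> both factorials in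
  \<open>N choose k\<close> have the same mean. The error allowance, in units of
  \<open>1 / m\<close>, is 2 from \<open>2 * T\<close>, 1/2 from \<open>2 * Q\<close> and 1/4 from
  Stirling's formula at \<open>2 * m\<close>, which stays below 3.\<close>

lemma binomial_entropy_asymptotics:
  assumes "m \<ge> 1"
  shows "\<bar>- (\<Sum>k\<le>2*m. let p = real (2*m choose k) / 2 ^ (2*m) in p * ln p)
           - 1/2 * ln (pi * exp 1 * real m)\<bar> \<le> 3 / real m"
proof -
  let ?E = "binomial_mean (2 * m)"
  define H where "H = - (\<Sum>k\<le>2*m. let p = real (2*m choose k) / 2 ^ (2*m) in p * ln p)"
  define T where "T = ?E (\<lambda>k. ln (fact k))"
  have m: "real m \<ge> 1" using assms by simp
  have "H = - ?E (\<lambda>k. (ln (fact (2*m)) - 2 * real m * ln 2) - (ln (fact k) + ln (fact (2*m - k))))"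
    unfolding H_def binomial_mean_def
  proof (intro arg_cong[where f = uminus] sum.cong refl, unfold Let_def)
    fix k assume "k \<in> {..2*m}"
    then have "real (2*m choose k) = fact (2*m) / (fact k * fact (2*m - k))"
      by (simp add: binomial_fact)
    then have "ln (real (2*m choose k) / 2 ^ (2*m)) 
       = (ln (fact (2*m)) - 2 * real m * ln 2) - (ln (fact k) + ln (fact (2*m - k)))"
      by (simp add: ln_div ln_mult ln_realpow)
    then show "real (2*m choose k) / 2 ^ (2*m) * ln (real (2*m choose k) / 2 ^ (2*m)) 
       = real (2*m choose k) / 2 ^ (2*m) * ((ln (fact (2*m)) - 2 * real m * ln 2) - (ln (fact k) + ln (fact (2*m - k))))"
      by simp
  qed
  also have "\<dots> = 2 * real m * ln 2 - ln (fact (2*m)) + 2 * T"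
    unfolding binomial_mean_diff binomial_mean_add binomial_mean_const
    using binomial_mean_reflect[of "2*m" "\<lambda>k. ln (fact k)"] by (simp add: T_def)
  finally have H: "H = 2 * real m * ln 2 - ln (fact (2*m)) + 2 * T" .
  \<comment> \<open>Named atoms make the conclusion linear. The large terms \<open>P\<close> and
    \<open>W\<close> cancel, and \<open>Q\<close>, which records the passage from
    \<open>ln (m + 1)\<close> to \<open>ln m\<close>, tends to 1.\<close>
  define P where "P = (2 * real m + 1) * ln (real m)"
  define Q where "Q = (real m + 1/2) * ln (1 + 1 / real m)"
  define Z where "Z = (real m + 1/2) * ln (real m + 1)"
  define W where "W = 2 * real m * ln 2"
  define \<delta> where "\<delta> = 1 / real m"
  have \<delta>: "1 / (4 * real m) = \<delta> / 4" "3 / real m = 3 * \<delta>" "\<delta> > 0"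
    using m by (simp_all add: \<delta>_def)
  have R: "stirling_rest (2*m) \<le> ln (2 * pi) / 2 + \<delta> / 4" "ln (2 * pi) / 2 \<le> stirling_rest (2*m)"
    using stirling_rest_bounds[of "2*m"] assms by (simp_all add: \<delta>_def)
  have "stirling_rest (2*m) = ln (fact (2*m)) - ((2 * real m + 1/2) * (ln 2 + ln (real m)) - 2 * real m)"
    using m by (simp add: stirling_rest_def ln_mult)
  also have "(2 * real m + 1/2) * (ln 2 + ln (real m)) = W + ln 2 / 2 + P - ln (real m) / 2"
    by (simp add: W_def P_def algebra_simps)
  finally have S: "stirling_rest (2*m) = ln (fact (2*m)) - (W + ln 2 / 2 + P - ln (real m) / 2 - 2 * real m)" .
  have T: "\<bar>T - (Z + 1/4 - (real m + 1) + ln (2 * pi) / 2)\<bar> \<le> \<delta>"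
    unfolding T_def Z_def \<delta>_def by (rule binomial_mean_ln_fact[OF assms])
  have "real m + 1 = real m * (1 + 1 / real m)" "1 + 1 / real m > 0"
    using m by (simp_all add: field_simps add_pos_pos)
  then have "ln (real m + 1) = ln (real m) + ln (1 + 1 / real m)"
    using m ln_mult[of "real m" "1 + 1 / real m"] by simp
  then have Z: "Z = P / 2 + Q" by (simp add: Z_def P_def Q_def algebra_simps)
  have Q1: "1 \<le> Q" unfolding Q_def by (rule stirling_step_bounds[OF m])
  have "1 / (4 * real m ^ 2) \<le> 1 / (4 * real m)"
    using m by (intro frac_le) (auto simp: power2_eq_square)
  with stirling_step_bounds(2)[OF m] have Q2: "Q \<le> 1 + \<delta> / 4"
    unfolding Q_def \<delta>(1)[symmetric] by linarith
  have L: "ln (pi * exp 1 * real m) = ln 2 + ln pi + 1 + ln (real m) - ln 2" "ln (2 * pi) = ln 2 + ln pi"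
    using m by (simp_all add: ln_mult)
  show ?thesis unfolding H_def[symmetric] \<delta>(2) L(1)
    using H[folded W_def] R S T[unfolded abs_le_iff] Z Q1 Q2 \<delta>(3) L(2) by (intro abs_leI) argo+
qed

subsection \<open>The half cut\<close>

text \<open>With \<open>m\<close> sites on either side,
  \<open>m ^ k * m ^ (N - k) / (2 * m) ^ N\<close> is \<open>1 / 2 ^ N\<close>, so the Schmidt
  weights are those of fair coin tosses.\<close>

lemma ground_state_half_entropy:
  assumes "m \<ge> 1" "t > 0" and A: "A \<subseteq> {1..2*m}" "card A = m"
    and gs: "ground_state {1..2*m} N (bose_hubbard (2*m) t 0) \<psi>"
  shows "entanglement_entropy {1..2*m} A \<psi>
    = - (\<Sum>k\<le>N. let p = real (N choose k) / 2 ^ N in p * ln p)"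
proof -
  have m: "2 \<le> 2 * m" using assms(1) by simp
  obtain c where \<psi>: "\<And>n. \<psi> n = of_real (weight {1..2*m} n) * (c * indicator (shell {1..2*m} N) n)"
    and c: "(cmod c)\<^sup>2 * (real (2 * m) ^ N / fact N) = 1"
    using ground_state_unique[OF m assms(2) gs] by blast
  have fA: "finite A" and A0: "A \<noteq> {}" using A assms(1) finite_subset by auto
  have cS: "card {1..2*m} = 2 * m" by simp
  then have c': "(cmod c)\<^sup>2 * (real (card {1..2*m}) ^ N / fact N) = 1" using c by (simp only:)
  note pt = partial_trace_condensate[OF finite_atLeastAtMost A(1) A0 \<psi> c']
  have cB: "card ({1..2*m} - A) = m" using A fA by (simp add: card_Diff_subset)
  have half: "real (N choose k) * real m ^ k * real m ^ (N - k) / real (2 * m) ^ N = real (N choose k) / 2 ^ N"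
    if "k \<le> N" for k
  proof -
    have "real m ^ k * real m ^ (N - k) = real m ^ N" using that by (simp add: power_add[symmetric])
    then show ?thesis using assms(1) by (simp add: mult.assoc power_mult_distrib)
  qed
  show ?thesis
    unfolding entanglement_entropy_def pt(1)
    by (subst entropy_block_kernel[OF fA pt(2), where N = N], simp,
        intro arg_cong[where f = uminus] sum.cong refl)
      (simp only: atMost_iff if_True Let_def cS cB A(2) half)
qed

theorem mainTheorem6:
  "\<exists>C::real. \<forall>\<^sub>F Ns in sequentially. even Ns \<and> Ns \<ge> 4 \<longrightarrow>
     (\<forall>(t::real) A \<psi>. t > 0 \<and> A \<subseteq> {1..Ns} \<and> card A = Ns div 2 \<and>
        ground_state {1..Ns} Ns (bose_hubbard Ns t 0) \<psi> \<longrightarrow>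
        \<bar>entanglement_entropy {1..Ns} A \<psi> - 1 / 2 * ln (pi * exp 1 / 2 * real Ns)\<bar> \<le> C / real Ns)"
\<comment> \<open>With \<open>m = Ns / 2\<close> the error \<open>3 / m\<close> is
  \<open>6 / Ns\<close>, and it is available for every even \<open>Ns \<ge> 4\<close>.\<close>
proof (intro exI[of _ 6] always_eventually allI impI, elim conjE)
  fix Ns :: nat and t :: real and A \<psi>
  assume "even Ns" "Ns \<ge> 4" and t: "t > 0" and A: "A \<subseteq> {1..Ns}" "card A = Ns div 2"
    and gs: "ground_state {1..Ns} Ns (bose_hubbard Ns t 0) \<psi>"
  then obtain m where Ns: "Ns = 2 * m" and m: "m \<ge> 1" by (auto elim!: evenE)
  have "entanglement_entropy {1..Ns} A \<psi> = - (\<Sum>k\<le>2*m. let p = real (2*m choose k) / 2 ^ (2*m) in p * ln p)"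
    using ground_state_half_entropy[of m t A "2 * m" \<psi>] m t A gs by (simp add: Ns)
  moreover have "pi * exp 1 / 2 * real Ns = pi * exp 1 * real m" "6 / real Ns = 3 / real m"
    by (simp_all add: Ns)
  ultimately show "\<bar>entanglement_entropy {1..Ns} A \<psi> - 1 / 2 * ln (pi * exp 1 / 2 * real Ns)\<bar> \<le> 6 / real Ns"
    using binomial_entropy_asymptotics[OF m] by metis
qed

end
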